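(* Let $(X,d)$ be a geodesic metric space and $\mathcal{P}$ a collection of subsets. Suppose that for each pair of points $x,y\in X$ a path $\eta(x,y)$ connecting them and a closed subset $trans(x,y)\subseteq\eta(x,y)$ have been assigned so that the following conditions hold for some large enough $D$: (1) if $d(x,y)\le2$ then $diam(trans(x,y))\le D$; (2) for all $x',y'\in\eta(x,y)$ we have $d_{Haus}(trans(x',y'),\,trans(x,y)|_{[x',y']}\cup\{x',y'\})\le D$, where $trans(x,y)|_{[x',y']}=trans(x,y)\cap\eta(x,y)|_{[x',y']}$; (3) $trans(x,y)\subseteq N_D(trans(x,z)\cup trans(z,y))$ for all $x,y,z\in X$; (4) if $x',y'\in\eta(x,y)$ do not both lie on $P$ for any $P\in\mathcal{P}$, then there exists $z\in trans(x,y)$ between $x'$ and $y'$; (5) for each $K$ there exists $B$ so that $diam(N_K(P)\cap N_K(Q))\le B$ for all distinct $P,Q\in\mathcal{P}$; (6) for every $k$ there exists $K$ so that if $P\in\mathcal{P}$, $d(x,P),d(y,P)\le k$ and $d(x,y)\ge K$, then $trans(x,y)\subseteq B_K(x)\cup B_K(y)$ and there exists $z\in trans(x,y)\cap N_D(P)$. Then: (a) $X$ is hyperbolic relative to $\mathcal{P}$; (b) for every $C$ there exist $\mu,c_0,L$ with the following property: for any $c\ge c_0$ and any $(1,C)$-almost-geodesic $\beta$ with endpoints $x,y$, the Hausdorff distance between $trans(x,y)$ and $trans_{\mu,c}(\beta)$ is at most $L+c$.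
   Context: $N_K(A)=\{x\in X:d(x,A)\le K\}$; $B_K(x)$ is the ball of radius $K$ at $x$; $d_{Haus}$ is Hausdorff distance. For a path $\alpha$ and $p,q\in\alpha$, $\alpha|_{[p,q]}$ is the subpath of $\alpha$ joining $p$ to $q$. An almost-geodesic is a continuous quasi-geodesic. **Transient points.** For a path $\alpha$ in $X$, $deep_{\mu,c}(\alpha)$ is the set of $x\in\alpha$ for which there is a subpath $\beta$ of $\alpha$ containing $x$, with endpoints $x_1,x_2\in N_\mu(P)$ for some $P\in\mathcal{P}$, and $d(x,x_i)>c$ for $i=1,2$; $trans_{\mu,c}(\alpha)=\alpha\setminus deep_{\mu,c}(\alpha)$. **Relative hyperbolicity.** $(\alpha_1)$ is condition (5) of the claim. $(\alpha_2)$: there are $\epsilon\in(0,1/2)$, $M\ge0$ such that for each $P\in\mathcal{P}$ and $x,y\in N_{\epsilon d(x,y)}(P)$, any geodesic from $x$ to $y$ intersects $N_M(P)$. $X$ is $( * )$-asymptotically tree-graded with respect to $\mathcal{P}$ if for every $C\ge0$ there are $\sigma,\delta$ such that every triangle with $(1,C)$-almost-geodesic sides $\gamma_1,\gamma_2,\gamma_3$ satisfies either (C) some ball of radius $\sigma$ intersects all sides, or (P) there is $P\in\mathcal{P}$ such that $N_\sigma(P)$ intersects all sides and the entrance points $x_i$ and exit points $y_i$ of $\gamma_i$ in/from $N_\sigma(P)$ satisfy $d(y_i,x_{i+1})\le\delta$ (indices mod 3, sides oriented cyclically). $X$ is hyperbolic relative to $\mathcal{P}$ if $(\alpha_1)$,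 $(\alpha_2)$ hold and $X$ is $( * )$-asymptotically tree-graded with respect to $\mathcal{P}$. *)

theory Defs
  imports "HOL-Analysis.Analysis"
begin

(* The metric space X is the whole type 'a. *)

(* infdist x {} = 0, whereas d(x, {}) is infinite: hence the nonemptiness condition. *)
definition nbhd :: "real \<Rightarrow> 'a::metric_space set \<Rightarrow> 'a set" where
  "nbhd K A = {x. A \<noteq> {} \<and> infdist x A \<le> K}"

(* Extended-valued: infinite when there is no admissible r, e.g. when exactly one of the
   two sets is empty. *)
definition dHaus :: "'a::metric_space set \<Rightarrow> 'a set \<Rightarrow> ereal" where
  "dHaus A B = Inf {ereal r | r. 0 \<le> r \<and> A \<subseteq> nbhd r B \<and> B \<subseteq> nbhd r A}"

(* The library's diameter is a junk value on unbounded sets. *)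
definition diam_le :: "'a::metric_space set \<Rightarrow> real \<Rightarrow> bool" where
  "diam_le S D \<longleftrightarrow> bounded S \<and> diameter S \<le> D"

definition geodesic :: "(real \<Rightarrow> 'a::metric_space) \<Rightarrow> real \<Rightarrow> real \<Rightarrow> bool" where
  "geodesic \<gamma> a b \<longleftrightarrow>
     a \<le> b \<and> (\<forall>s\<in>{a..b}. \<forall>t\<in>{a..b}. dist (\<gamma> s) (\<gamma> t) = \<bar>s - t\<bar>)"

definition geodesic_space :: "'a::metric_space itself \<Rightarrow> bool" where
  "geodesic_space _ \<longleftrightarrow>
     (\<forall>x y::'a. \<exists>\<gamma> a b. geodesic \<gamma> a b \<and> \<gamma> a = x \<and> \<gamma> b = y)"

definition quasi_geodesic ::
    "real \<Rightarrow> real \<Rightarrow> (real \<Rightarrow> 'a::metric_space) \<Rightarrow> real \<Rightarrow> real \<Rightarrow> bool" where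
  "quasi_geodesic K C \<gamma> a b \<longleftrightarrow>
     a \<le> b \<and> (\<forall>s\<in>{a..b}. \<forall>t\<in>{a..b}.
       \<bar>s - t\<bar> / K - C \<le> dist (\<gamma> s) (\<gamma> t) \<and> dist (\<gamma> s) (\<gamma> t) \<le> K * \<bar>s - t\<bar> + C)"

definition almost_geodesic ::
    "real \<Rightarrow> real \<Rightarrow> (real \<Rightarrow> 'a::metric_space) \<Rightarrow> real \<Rightarrow> real \<Rightarrow> bool" where
  "almost_geodesic K C \<gamma> a b \<longleftrightarrow> quasi_geodesic K C \<gamma> a b \<and> continuous_on {a..b} \<gamma>"

(* Paths need not be injective: a subpath is the restriction to a parameter interval,
   while deep and transient points are points of the image. *)
definition deep_pts ::
    "'a::metric_space set set \<Rightarrow> real \<Rightarrow> real \<Rightarrow> (real \<Rightarrow> 'a) \<Rightarrow> real \<Rightarrow> real \<Rightarrow> 'a set" where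
  "deep_pts \<P> \<mu> c \<alpha> a b = {x \<in> \<alpha> ` {a..b}.
     \<exists>s t. a \<le> s \<and> s \<le> t \<and> t \<le> b \<and> x \<in> \<alpha> ` {s..t} \<and>
       (\<exists>P\<in>\<P>. \<alpha> s \<in> nbhd \<mu> P \<and> \<alpha> t \<in> nbhd \<mu> P) \<and>
       c < dist x (\<alpha> s) \<and> c < dist x (\<alpha> t)}"

definition trans_pts ::
    "'a::metric_space set set \<Rightarrow> real \<Rightarrow> real \<Rightarrow> (real \<Rightarrow> 'a) \<Rightarrow> real \<Rightarrow> real \<Rightarrow> 'a set" where
  "trans_pts \<P> \<mu> c \<alpha> a b = \<alpha> ` {a..b} - deep_pts \<P> \<mu> c \<alpha> a b"

(* First and last point of the path in A. They are only used when the path is continuous and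
   meets the closed set A, in which case the infimum and the supremum are attained. *)
definition entrance_pt ::
    "(real \<Rightarrow> 'a::metric_space) \<Rightarrow> real \<Rightarrow> real \<Rightarrow> 'a set \<Rightarrow> 'a" where
  "entrance_pt \<gamma> a b A = \<gamma> (Inf {t \<in> {a..b}. \<gamma> t \<in> A})"

definition exit_pt ::
    "(real \<Rightarrow> 'a::metric_space) \<Rightarrow> real \<Rightarrow> real \<Rightarrow> 'a set \<Rightarrow> 'a" where
  "exit_pt \<gamma> a b A = \<gamma> (Sup {t \<in> {a..b}. \<gamma> t \<in> A})"

definition alpha1 :: "'a::metric_space set set \<Rightarrow> bool" where
  "alpha1 \<P> \<longleftrightarrow>
     (\<forall>K. \<exists>B. \<forall>P\<in>\<P>. \<forall>Q\<in>\<P>. P \<noteq> Q \<longrightarrow> diam_le (nbhd K P \<inter> nbhd K Q) B)"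

definition alpha2 :: "'a::metric_space set set \<Rightarrow> bool" where
  "alpha2 \<P> \<longleftrightarrow>
     (\<exists>\<epsilon> M. 0 < \<epsilon> \<and> \<epsilon> < 1/2 \<and> 0 \<le> M \<and>
       (\<forall>P\<in>\<P>. \<forall>x y. x \<in> nbhd (\<epsilon> * dist x y) P \<and> y \<in> nbhd (\<epsilon> * dist x y) P \<longrightarrow>
         (\<forall>\<gamma> a b. geodesic \<gamma> a b \<and> \<gamma> a = x \<and> \<gamma> b = y \<longrightarrow> \<gamma> ` {a..b} \<inter> nbhd M P \<noteq> {})))"

(* The sides of a triangle are numbered 0, 1, 2 and oriented cyclically; side i is \<gamma> i,
   parametrised by the interval from a i to b i. *)
definition almost_geodesic_triangle ::
    "real \<Rightarrow> real \<Rightarrow> (nat \<Rightarrow> real \<Rightarrow> 'a::metric_space) \<Rightarrow> (nat \<Rightarrow> real) \<Rightarrow> (nat \<Rightarrow> real) \<Rightarrow> bool"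
  where
  "almost_geodesic_triangle K C \<gamma> a b \<longleftrightarrow>
     (\<forall>i<3. almost_geodesic K C (\<gamma> i) (a i) (b i) \<and>
        \<gamma> i (b i) = \<gamma> ((i + 1) mod 3) (a ((i + 1) mod 3)))"

definition star_asymptotically_tree_graded :: "'a::metric_space set set \<Rightarrow> bool" where
  "star_asymptotically_tree_graded \<P> \<longleftrightarrow>
     (\<forall>C\<ge>0. \<exists>\<sigma> \<delta>. \<forall>\<gamma> a b. almost_geodesic_triangle 1 C \<gamma> a b \<longrightarrow>
        (\<exists>p. \<forall>i<3. \<gamma> i ` {a i..b i} \<inter> cball p \<sigma> \<noteq> {}) \<or>
        (\<exists>P\<in>\<P>.
           (\<forall>i<3. \<gamma> i ` {a i..b i} \<inter> nbhd \<sigma> P \<noteq> {}) \<and>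
           (\<forall>i<3. let j = (i + 1) mod 3 in
              dist (exit_pt (\<gamma> i) (a i) (b i) (nbhd \<sigma> P))
                   (entrance_pt (\<gamma> j) (a j) (b j) (nbhd \<sigma> P)) \<le> \<delta>)))"

definition rel_hyperbolic :: "'a::metric_space set set \<Rightarrow> bool" where
  "rel_hyperbolic \<P> \<longleftrightarrow> alpha1 \<P> \<and> alpha2 \<P> \<and> star_asymptotically_tree_graded \<P>"

end

theory Submission
  imports Defs "HOL-Real_Asymp.Real_Asymp"
begin

text \<open>The key is that transient sets stay at bounded distance from almost-geodesics.
  Condition (3), applied along a binary subdivision, puts \<open>trans x y\<close> in the
  \<open>D log n\<close>-neighbourhood of every path of \<open>n\<close> steps from \<open>x\<close> to \<open>y\<close>, where by (6) a jump between two
  points near the same peripheral set counts as one step. By (6) again, the point where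
  \<open>\<eta> x q\<close> enters a neighbourhood of \<open>P\<close> is coarsely independent of \<open>q \<in> P\<close>; this defines a coarse
  projection to \<open>P\<close>, through which \<open>trans x y\<close> passes whenever \<open>x\<close> and \<open>y\<close> project far apart. With the
  logarithmic bound, paths far away from \<open>P\<close> project to sets of controlled size, and thus
  almost-geodesics with endpoints near \<open>P\<close> stay near \<open>P\<close>. Then a point \<open>p\<close> of \<open>trans x y\<close>
  at maximal distance \<open>r\<close> from an almost-geodesic can be bypassed by \<open>O(r)\<close> steps (jumps included)
  staying \<open>r/2\<close> away from \<open>p\<close>, which bounds \<open>r\<close>. Both claims follow by looking at a jump of
  \<open>trans x y\<close> from one part of the almost-geodesic (or triangle) to another, which by (4) is
  either short or has both ends near a common peripheral set.\<close>

section \<open>Neighbourhoods, closed sets of reals, logarithms\<close>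

text \<open>The hypotheses control transient sets only: between transient points
  \<open>\<eta> x y\<close> may wander inside peripheral sets, and no bound on its length is
  available. The arguments therefore move along the parameters of transient points. A nearest-point
  projection would have no a priori relation to these sets, whereas one read off from
  \<open>\<eta>\<close> can be compared with them through (2), (3) and (6).

  The logarithm is the price of halving: each level costs one use of (3). Any sublinear bound in the
  number of steps would do, as it is always played against a linear quantity. The contraction of
  projections is used at two scales, with pieces of fixed length for \<open>alpha2\<close> and with
  pieces of length about r for quasiconvexity. The latter has to precede the comparison of transient
  sets with almost-geodesics: a bypass of O(r) steps is available only if an almost-geodesic with
  ends near a peripheral set is already known to stay near it, at a distance linear in r.\<close>

lemma nbhd_mono: "x \<in> nbhd k P \<Longrightarrow> k \<le> l \<Longrightarrow> x \<in> nbhd l P"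
  by (auto simp: nbhd_def)

lemma nbhd_move: "x \<in> nbhd k P \<Longrightarrow> dist x y \<le> e \<Longrightarrow> y \<in> nbhd (k + e) P"
  using infdist_triangle[of y P x] by (auto simp: nbhd_def dist_commute)

lemma nbhd_memI: "q \<in> P \<Longrightarrow> dist x q \<le> k \<Longrightarrow> x \<in> nbhd k P"
  using infdist_le2[of q P x k] by (auto simp: nbhd_def)

lemma nbhd_memE:
  assumes "x \<in> nbhd k P" "k < l"
  obtains q where "q \<in> P" "dist x q < l"
proof -
  have "P \<noteq> {}" "infdist x P < l" using assms by (auto simp: nbhd_def)
  then show ?thesis
    using that cInf_lessD[of "dist x ` P" l] by (auto simp: infdist_def)
qed

lemma closed_nbhd: "closed (nbhd k P)"
proof (cases "P = {}")
  case False
  have "nbhd k P = (\<lambda>x. infdist x P) -` {..k}" using False by (auto simp: nbhd_def)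
  then show ?thesis by (simp add: closed_vimage continuous_on_infdist)
qed (simp add: nbhd_def)

lemma dHaus_leD:
  assumes "dHaus A B \<le> ereal D" "D < D'" "x \<in> A"
  shows "\<exists>y\<in>B. dist x y \<le> D'"
proof -
  have "dHaus A B < ereal D'" using assms(1,2) by (simp add: le_less_trans)
  then obtain r where r: "r < D'" "A \<subseteq> nbhd r B"
    unfolding dHaus_def Inf_less_iff by auto
  have "x \<in> nbhd r B" using r(2) assms(3) by blast
  then show ?thesis using r(1) by (rule nbhd_memE) (blast intro: less_imp_le)
qed

lemma dHaus_commute: "dHaus A B = dHaus B A"
  unfolding dHaus_def by (rule arg_cong[where f=Inf]) auto

section \<open>First points, last points and gaps of closed sets of reals\<close>

lemma closed_first:
  fixes S :: "real set"
  assumes "closed S" "s \<in> S" "a \<le> s"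
  obtains t where "t \<in> S" "a \<le> t" "t \<le> s" "\<forall>u\<in>S. a \<le> u \<longrightarrow> t \<le> u"
proof -
  have c: "compact (S \<inter> {a..s})" using assms(1) by (intro closed_Int_compact) auto
  then obtain t where t: "t \<in> S \<inter> {a..s}" "\<forall>u\<in>S \<inter> {a..s}. t \<le> u"
    using compact_attains_inf[OF c] assms(2,3) by (metis IntI atLeastAtMost_iff empty_iff order.refl)
  show ?thesis
  proof (rule that[of t])
    show "\<forall>u\<in>S. a \<le> u \<longrightarrow> t \<le> u"
    proof (intro ballI impI)
      show "t \<le> u" if "u \<in> S" "a \<le> u" for u using t that by (cases "u \<le> s") auto
    qed
  qed (use t in auto)
qed

lemma closed_last:
  fixes S :: "real set"
  assumes "closed S" "s \<in> S" "s \<le> b"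
  obtains t where "t \<in> S" "s \<le> t" "t \<le> b" "\<forall>u\<in>S. u \<le> b \<longrightarrow> u \<le> t"
proof -
  have "closed (uminus ` S)" using assms(1) by (rule closed_negations)
  then obtain t where t: "t \<in> uminus ` S" "- b \<le> t" "t \<le> - s"
      "\<forall>u\<in>uminus ` S. - b \<le> u \<longrightarrow> t \<le> u"
    by (rule closed_first[of "uminus ` S" "- s" "- b"]) (use assms(2,3) in auto)
  show ?thesis
  proof (rule that[of "- t"])
    show "\<forall>u\<in>S. u \<le> b \<longrightarrow> u \<le> - t" using t(4) by fastforce
  qed (use t in auto)
qed

text \<open>As \<open>A\<close> is arbitrary, it may fail at the supremum of the points that satisfy
  it. If a point failing \<open>A\<close> lies at this supremum or shortly after it, a short pair
  results; otherwise the supremum satisfies \<open>A\<close> and the next point of \<open>S\<close>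
  lies beyond a gap.\<close>

lemma closed_jump:
  fixes S :: "real set"
  assumes "closed S" "s0 \<in> S" "t0 \<in> S" "s0 \<le> t0" "A s0" "\<not> A t0" "0 < e"
  obtains s t where "s \<in> S" "t \<in> S" "s0 \<le> s" "s < t" "t \<le> t0"
    "t - s < e \<or> S \<inter> {s<..<t} = {}" "A s" "\<not> A t"
proof -
  define U where "U = {s \<in> S. s0 \<le> s \<and> s \<le> t0 \<and> A s}"
  define m where "m = Sup U"
  have U: "s0 \<in> U" "bdd_above U" using assms by (auto simp: U_def intro!: bdd_aboveI[of _ t0])
  have mb: "s0 \<le> m" "m \<le> t0"
    using U by (auto simp: m_def U_def intro!: cSup_upper cSup_least)
  have up: "s \<le> m" if "s \<in> U" for s using that U by (auto simp: m_def intro: cSup_upper)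
  obtain s where s: "s \<in> U" "m - e/2 < s"
    using less_cSupE[of "m - e/2" U] U assms(7) by (auto simp: m_def)
  have mS: "m \<in> S"
  proof -
    have "m \<in> closure U" unfolding m_def using U by (intro closure_contains_Sup) auto
    also have "\<dots> \<subseteq> closure S" by (rule closure_mono) (auto simp: U_def)
    finally show ?thesis using assms(1) by simp
  qed
  show ?thesis
  proof (cases "\<exists>t\<in>S. m \<le> t \<and> t \<le> t0 \<and> \<not> A t \<and> t < m + e/2")
    case True
    then obtain t where t: "t \<in> S" "m \<le> t" "t \<le> t0" "\<not> A t" "t < m + e/2" by auto
    have "s \<noteq> t" using s t by (auto simp: U_def)
    then show ?thesis using that[of s t] s t up[OF s(1)] by (auto simp: U_def)
  next
    case False
    then have Am: "A m" using mS mb assms(7) by force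
    then have mt: "m < t0" using mb assms(6) by (metis less_le)
    define V where "V = S \<inter> {m + e/2..t0}"
    have t0V: "t0 \<in> V" using False assms(3,6) mt by (auto simp: V_def)
    have "closed V" unfolding V_def using assms(1) by (intro closed_Int) auto
    moreover have bb: "bdd_below V" by (auto simp: V_def intro!: bdd_belowI[of _ "m + e/2"])
    ultimately have tV: "Inf V \<in> V" using t0V closed_contains_Inf by blast
    have nA: "\<not> A t" if "t \<in> S" "m < t" "t \<le> t0" for t
      using up[of t] that mb by (auto simp: U_def)
    have "S \<inter> {m<..<Inf V} = {}"
    proof -
      have False if u: "u \<in> S" "m < u" "u < Inf V" for u
      proof -
        have "u \<le> t0" using u tV by (auto simp: V_def)
        moreover have "u \<notin> V" using u(3) bb cInf_lower by force
        ultimately show False using False nA[of u] u by (force simp: V_def)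
      qed
      then show ?thesis by auto
    qed
    moreover have "m < Inf V" "Inf V \<in> S" "Inf V \<le> t0" using tV assms(7) by (auto simp: V_def)
    ultimately show ?thesis using that[of m "Inf V"] nA[of "Inf V"] mS mb Am by auto
  qed
qed

text \<open>Serves for detours of \<open>c * r\<close> steps: halving to depth \<open>m\<close>
  exhausts them, and the loss \<open>D * m\<close> is only logarithmic in \<open>r\<close>.\<close>

lemma log_bound:
  fixes c D :: real
  assumes "0 < D" "0 < c"
  shows "\<exists>r0\<ge>1. \<forall>r\<ge>r0. \<exists>m::nat. c * r \<le> 2 ^ m \<and> D * m + c < r / 2"
proof -
  have "eventually (\<lambda>r. D * (log 2 (c * r) + 1) + c < r / 2 \<and> 1 \<le> c * r) at_top"
  proof (rule eventually_conj)
    have "((\<lambda>r. (D * (log 2 (c * r) + 1) + c) / r) \<longlongrightarrow> 0) at_top"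
      using assms by real_asymp
    then have "eventually (\<lambda>r. (D * (log 2 (c * r) + 1) + c) / r < 1/2) at_top"
      by (rule order_tendstoD) simp
    then show "eventually (\<lambda>r. D * (log 2 (c * r) + 1) + c < r / 2) at_top"
      using eventually_gt_at_top[of 0] by eventually_elim (auto simp: field_simps)
    show "eventually (\<lambda>r. 1 \<le> c * r) at_top" using assms
      using eventually_ge_at_top[of "1/c"] by (auto simp: field_simps)
  qed
  then obtain r0 where r0: "\<And>r. r \<ge> r0 \<Longrightarrow> D * (log 2 (c * r) + 1) + c < r / 2 \<and> 1 \<le> c * r"
    by (auto simp: eventually_at_top_linorder)
  have "\<exists>m::nat. c * r \<le> 2 ^ m \<and> D * m + c < r / 2" if "r \<ge> r0" for r
  proof -
    define m where "m = nat \<lceil>log 2 (c * r)\<rceil>"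
    have l0: "0 \<le> log 2 (c * r)" using r0[OF that] by simp
    have "c * r = 2 powr log 2 (c * r)" using r0[OF that] by simp
    also have "\<dots> \<le> 2 powr m" using real_nat_ceiling_ge[of "log 2 (c * r)"] by (intro powr_mono) (simp_all add: m_def)
    finally have "c * r \<le> 2 ^ m" by (simp add: powr_realpow)
    moreover have "real m \<le> log 2 (c * r) + 1" using l0 by (simp add: m_def)
    then have "D * m \<le> D * (log 2 (c * r) + 1)" using assms by simp
    ultimately show ?thesis using r0[OF that] by (intro exI[of _ m]) linarith
  qed
  then show ?thesis by (intro exI[of _ "max 1 r0"]) auto
qed

section \<open>Transient sets along coarse paths\<close>

text \<open>Pointwise form of the hypotheses, with \<open>D\<close> taken slightly larger than the
  given constant, so that infima of distances turn into actual nearby points.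
  \<open>T_restrict\<close> and \<open>T_extend\<close> are the two halves of the Hausdorff bound in
  (2).\<close>

locale guessed_paths =
  fixes \<P> :: "'a::metric_space set set"
    and \<eta> :: "'a \<Rightarrow> 'a \<Rightarrow> real \<Rightarrow> 'a"
    and T :: "'a \<Rightarrow> 'a \<Rightarrow> 'a set"
    and D :: real
  assumes geodesic_space: "geodesic_space TYPE('a)"
    and D_ge_1: "1 \<le> D"
    and path_\<eta>: "path (\<eta> x y)"
    and \<eta>_0 [simp]: "\<eta> x y 0 = x"
    and \<eta>_1 [simp]: "\<eta> x y 1 = y"
    and closed_T: "closed (T x y)"
    and T_subset: "T x y \<subseteq> path_image (\<eta> x y)"
    and T_short: "dist x y \<le> 2 \<Longrightarrow> p \<in> T x y \<Longrightarrow> q \<in> T x y \<Longrightarrow> dist p q \<le> D"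
    and T_restrict: "s \<in> {0..1} \<Longrightarrow> t \<in> {0..1} \<Longrightarrow> p \<in> T (\<eta> x y s) (\<eta> x y t) \<Longrightarrow>
      \<exists>q\<in>(T x y \<inter> \<eta> x y ` closed_segment s t) \<union> {\<eta> x y s, \<eta> x y t}. dist p q \<le> D"
    and T_extend: "s \<in> {0..1} \<Longrightarrow> t \<in> {0..1} \<Longrightarrow>
      q \<in> (T x y \<inter> \<eta> x y ` closed_segment s t) \<union> {\<eta> x y s, \<eta> x y t} \<Longrightarrow>
      \<exists>p\<in>T (\<eta> x y s) (\<eta> x y t). dist q p \<le> D"
    and T_triangle: "p \<in> T x y \<Longrightarrow> \<exists>q\<in>T x z \<union> T z y. dist p q \<le> D"
    and T_between: "s \<in> {0..1} \<Longrightarrow> t \<in> {0..1} \<Longrightarrow>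
      \<forall>P\<in>\<P>. \<eta> x y s \<in> P \<longrightarrow> \<eta> x y t \<notin> P \<Longrightarrow>
      T x y \<inter> \<eta> x y ` closed_segment s t \<noteq> {}"
    and peripherals_bounded: "\<exists>B. \<forall>P\<in>\<P>. \<forall>Q\<in>\<P>. P \<noteq> Q \<longrightarrow>
      (\<forall>x \<in> nbhd k P \<inter> nbhd k Q. \<forall>y \<in> nbhd k P \<inter> nbhd k Q. dist x y \<le> B)"
    and T_peripheral: "\<exists>K. \<forall>P\<in>\<P>. \<forall>x\<in>nbhd k P. \<forall>y\<in>nbhd k P. K \<le> dist x y \<longrightarrow>
      T x y \<subseteq> cball x K \<union> cball y K \<and> T x y \<inter> nbhd D P \<noteq> {}"
begin

lemma geodesicE:
  fixes x y :: 'a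
  obtains \<gamma> where "\<gamma> 0 = x" "\<gamma> (dist x y) = y"
    "\<And>s t. s \<in> {0..dist x y} \<Longrightarrow> t \<in> {0..dist x y} \<Longrightarrow> dist (\<gamma> s) (\<gamma> t) = \<bar>s - t\<bar>"
proof -
  obtain \<gamma> a b where g: "geodesic \<gamma> a b" "\<gamma> a = x" "\<gamma> b = y"
    using geodesic_space by (auto simp: geodesic_space_def) metis
  have ab: "a \<le> b" and gd: "\<And>s t. s \<in> {a..b} \<Longrightarrow> t \<in> {a..b} \<Longrightarrow> dist (\<gamma> s) (\<gamma> t) = \<bar>s - t\<bar>"
    using g(1) by (auto simp: geodesic_def)
  have d: "dist x y = b - a" using gd[of a b] ab g by auto
  have "dist (\<gamma> (a + s)) (\<gamma> (a + t)) = \<bar>s - t\<bar>" if "s \<in> {0..dist x y}" "t \<in> {0..dist x y}" for s t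
    using gd[of "a + s" "a + t"] that d by auto
  then show ?thesis using that[of "\<lambda>t. \<gamma> (a + t)"] g d by auto
qed

lemma continuous_\<eta>: "continuous_on {0..1} (\<eta> x y)"
  using path_\<eta> by (simp add: path_def)

lemma \<eta>_uniform:
  assumes "0 < e"
  obtains d where "0 < d" "\<And>s t. s \<in> {0..1} \<Longrightarrow> t \<in> {0..1} \<Longrightarrow> \<bar>s - t\<bar> < d \<Longrightarrow> dist (\<eta> x y s) (\<eta> x y t) < e"
proof -
  have "uniformly_continuous_on {0..1} (\<eta> x y)"
    using continuous_\<eta> compact_uniformly_continuous by blast
  then obtain d where "0 < d"
    "\<And>s t. s \<in> {0..1} \<Longrightarrow> t \<in> {0..1} \<Longrightarrow> dist t s < d \<Longrightarrow> dist (\<eta> x y t) (\<eta> x y s) < e"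
    using assms unfolding uniformly_continuous_on_def by metis
  then show ?thesis using that[of d] by (auto simp: dist_real_def)
qed

text \<open>The end points belong to one side of (2), which for the whole path therefore puts a
  transient point near each of them; in particular \<open>T x y\<close> is not empty.\<close>

lemma T_start: "\<exists>p\<in>T x y. dist x p \<le> D"
  using T_extend[of 0 1 x x y] by auto

lemma T_finish: "\<exists>p\<in>T x y. dist y p \<le> D"
  using T_extend[of 0 1 y x y] by auto

text \<open>Nothing relates \<open>\<eta> x y\<close> to \<open>\<eta> y x\<close> directly; (2) for
  \<open>\<eta> y x\<close>, with its two parameters in reverse order, does.\<close>

lemma T_commute:
  assumes "p \<in> T x y"
  shows "\<exists>q\<in>T y x. dist p q \<le> 2 * D"
proof -
  obtain q where q: "q \<in> T y x \<union> {x, y}" "dist p q \<le> D"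
    using T_restrict[of 1 0 p y x] assms by auto
  obtain z where "z \<in> T y x" "dist q z \<le> D"
  proof -
    have "\<exists>z\<in>T y x. dist q z \<le> D"
      using q(1) T_start[of y x] T_finish[of y x] D_ge_1 by (auto intro: bexI[of _ q])
    then show ?thesis using that by blast
  qed
  then show ?thesis using q(2) dist_triangle[of p z q] by (intro bexI[of _ z]) auto
qed

text \<open>Parameters keep the order along a path that need not be injective. The ends are added so
  that a property distinguishing \<open>x\<close> from \<open>y\<close> has to change somewhere
  along the set.\<close>

definition par :: "'a \<Rightarrow> 'a \<Rightarrow> real set" where
  "par x y = {s \<in> {0..1}. \<eta> x y s \<in> T x y} \<union> {0, 1}"

lemma par_subset: "par x y \<subseteq> {0..1}"
  by (auto simp: par_def)

lemma closed_par: "closed (par x y)"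
proof -
  have "closed ({0..1} \<inter> \<eta> x y -` T x y)"
    using continuous_\<eta> closed_T by (intro continuous_closed_preimage) auto
  then show ?thesis unfolding par_def vimage_def Int_def by (auto intro!: closed_Un)
qed

lemma par_T:
  assumes "s \<in> par x y"
  shows "\<exists>p\<in>T x y. dist (\<eta> x y s) p \<le> D"
  using assms T_start[of x y] T_finish[of x y] D_ge_1
  by (auto simp: par_def intro: bexI[of _ "\<eta> x y s"])

lemma T_parE:
  assumes "p \<in> T x y"
  obtains s where "s \<in> par x y" "p = \<eta> x y s"
  proof -
  obtain s where "s \<in> {0..1}" "p = \<eta> x y s" using assms T_subset[of x y] unfolding path_image_def by blast
  then show ?thesis using assms that[of s] by (simp add: par_def)
qed

text \<open>Condition (4) speaks of closed segments, but the ends \<open>s\<close> and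
  \<open>t\<close> may be transient. It is applied to a slightly shorter segment inside the gap; by
  uniform continuity the correction is at most 1.\<close>

lemma gap_peripheral:
  assumes "0 \<le> s" "s < t" "t \<le> 1" "par x y \<inter> {s<..<t} = {}"
  shows "\<exists>P\<in>\<P>. \<eta> x y s \<in> nbhd 1 P \<and> \<eta> x y t \<in> nbhd 1 P"
proof -
  obtain d where d: "0 < d"
    "\<And>s t. s \<in> {0..1} \<Longrightarrow> t \<in> {0..1} \<Longrightarrow> \<bar>s - t\<bar> < d \<Longrightarrow> dist (\<eta> x y s) (\<eta> x y t) < 1"
    using \<eta>_uniform[of 1 x y] by auto
  define e where "e = min (d/2) ((t - s)/3)"
  have e: "0 < e" "e < d" "s + e \<le> t - e" using d assms by (auto simp: e_def min_def field_simps)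
  have cs: "closed_segment (s + e) (t - e) = {s + e..t - e}"
    using e by (simp add: closed_segment_eq_real_ivl)
  have "T x y \<inter> \<eta> x y ` closed_segment (s + e) (t - e) = {}"
  proof -
    have False if "\<eta> x y u \<in> T x y" "u \<in> {s + e..t - e}" for u
    proof -
      have "u \<in> par x y" using that assms e by (auto simp: par_def)
      moreover have "u \<in> {s<..<t}" using that e by auto
      ultimately show False using assms(4) by blast
    qed
    then show ?thesis unfolding cs by blast
  qed
  then obtain P where P: "P \<in> \<P>" "\<eta> x y (s + e) \<in> P" "\<eta> x y (t - e) \<in> P"
    using T_between[of "s + e" "t - e" x y] assms e by auto
  have "dist (\<eta> x y s) (\<eta> x y (s + e)) < 1" "dist (\<eta> x y t) (\<eta> x y (t - e)) < 1"
    using e assms by (auto intro!: d(2))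
  then have "\<eta> x y s \<in> nbhd 1 P" "\<eta> x y t \<in> nbhd 1 P"
    using nbhd_memI[OF P(2)] nbhd_memI[OF P(3)] by auto
  then show ?thesis using P(1) by blast
qed

definition jump :: "real \<Rightarrow> 'a \<Rightarrow> 'a \<Rightarrow> bool" where
  "jump k u v \<longleftrightarrow> dist u v \<le> k \<or> (\<exists>P\<in>\<P>. u \<in> nbhd k P \<and> v \<in> nbhd k P)"

lemma jump_commute: "jump k u v \<longleftrightarrow> jump k v u"
  by (auto simp: jump_def dist_commute)

text \<open>An intermediate value principle for the possibly disconnected set
  \<open>par x y\<close>: a change of \<open>A\<close> is found either over an interval so short
  that the points are at distance less than 1, or across a gap, whose ends are near a common
  peripheral set.\<close>

lemma par_jump_ordered:
  assumes "s0 \<in> par x y" "t0 \<in> par x y" "A s0" "\<not> A t0" "s0 \<le> t0"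
  obtains s t where "s \<in> par x y" "t \<in> par x y" "s \<in> closed_segment s0 t0" "t \<in> closed_segment s0 t0"
    "A s" "\<not> A t" "jump 1 (\<eta> x y s) (\<eta> x y t)"
proof -
  obtain d where d: "0 < d"
    "\<And>s t. s \<in> {0..1} \<Longrightarrow> t \<in> {0..1} \<Longrightarrow> \<bar>s - t\<bar> < d \<Longrightarrow> dist (\<eta> x y s) (\<eta> x y t) < 1"
    using \<eta>_uniform[of 1 x y] by auto
  obtain s t where st: "s \<in> par x y" "t \<in> par x y" "s0 \<le> s" "s < t" "t \<le> t0" "A s" "\<not> A t"
    "t - s < d \<or> par x y \<inter> {s<..<t} = {}"
    using closed_jump[OF closed_par[of x y] assms(1,2,5,3,4) d(1)] by metis
  have b: "s \<in> {0..1}" "t \<in> {0..1}" using st par_subset by blast+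
  have "jump 1 (\<eta> x y s) (\<eta> x y t)"
    using st(8)
  proof
    assume "t - s < d"
    then show ?thesis using d(2)[OF b] st by (auto simp: jump_def)
  next
    assume "par x y \<inter> {s<..<t} = {}"
    then show ?thesis using gap_peripheral[of s t x y] b st by (auto simp: jump_def)
  qed
  then show ?thesis using that[of s t] st by (auto simp: closed_segment_eq_real_ivl)
qed

lemma par_jump:
  assumes "s0 \<in> par x y" "t0 \<in> par x y" "A s0" "\<not> A t0"
  obtains s t where "s \<in> par x y" "t \<in> par x y" "s \<in> closed_segment s0 t0" "t \<in> closed_segment s0 t0"
    "A s" "\<not> A t" "jump 1 (\<eta> x y s) (\<eta> x y t)"
proof (cases "s0 \<le> t0")
  case True
  then show ?thesis using that by (rule par_jump_ordered[OF assms])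
next
  case False
  then show ?thesis
    using par_jump_ordered[of t0 x y s0 "\<lambda>s. \<not> A s" thesis] assms that
    by (metis closed_segment_commute jump_commute less_eq_real_def linorder_not_le)
qed

section \<open>Transient sets of pairs at bounded distance\<close>

lemma T_small_nat:
  "dist x y \<le> real n \<Longrightarrow> p \<in> T x y \<Longrightarrow> dist x p \<le> 2 * D + real n * (1 + D)"
proof (induction n arbitrary: x y p)
  case (Suc n)
  have short: "dist x q \<le> 2 * D" if "dist x z \<le> 2" "q \<in> T x z" for z q
  proof -
    obtain p' where "p' \<in> T x z" "dist x p' \<le> D" using T_start by blast
    then show ?thesis using T_short[OF that(1), of p' q] that(2) dist_triangle[of x q p'] by auto
  qed
  show ?case
  proof (cases "dist x y \<le> 2")
    case True
    then show ?thesis using short[of y p] Suc D_ge_1 by (smt (verit) mult_nonneg_nonneg of_nat_0_le_iff)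
  next
    case False
    \<comment> \<open>Cutting a unit piece off a geodesic costs 1 for its length and
      \<open>D\<close> for one use of (3), hence the slope \<open>1 + D\<close>.\<close>
    obtain g where g: "g 0 = x" "g (dist x y) = y"
      "\<And>s t. s \<in> {0..dist x y} \<Longrightarrow> t \<in> {0..dist x y} \<Longrightarrow> dist (g s) (g t) = \<bar>s - t\<bar>"
      using geodesicE by blast
    have z: "dist x (g 1) = 1" "dist (g 1) y \<le> real n"
      using g(3)[of 0 1] g(3)[of 1 "dist x y"] g(1,2) False Suc.prems by auto
    obtain q where q: "q \<in> T x (g 1) \<union> T (g 1) y" "dist p q \<le> D"
      using T_triangle Suc.prems by blast
    have "dist x q \<le> 1 + (2 * D + real n * (1 + D))"
      using q(1)
    proof
      assume "q \<in> T x (g 1)"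
      then show ?thesis using short[of "g 1" q] z D_ge_1 by (smt (verit) mult_nonneg_nonneg of_nat_0_le_iff)
    next
      assume "q \<in> T (g 1) y"
      then show ?thesis using Suc.IH[OF z(2), of q] dist_triangle[of x q "g 1"] z(1) by linarith
    qed
    then show ?thesis using q(2) dist_triangle[of x p q] by (simp add: algebra_simps dist_commute)
  qed
next
  case 0
  obtain p' where "p' \<in> T x y" "dist x p' \<le> D" using T_start by blast
  then show ?case using T_short[of x y p' p] 0 dist_triangle[of x p p'] by auto
qed

lemma T_small: "\<exists>E\<ge>0. \<forall>x y. dist x y \<le> k \<longrightarrow> (\<forall>p\<in>T x y. dist x p \<le> E)"
proof (intro exI[of _ "2 * D + real (nat \<lceil>k\<rceil>) * (1 + D)"] conjI allI impI ballI)
  show "0 \<le> 2 * D + real (nat \<lceil>k\<rceil>) * (1 + D)" using D_ge_1 by auto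
  fix x y p assume "dist x y \<le> k" "p \<in> T x y"
  then show "dist x p \<le> 2 * D + real (nat \<lceil>k\<rceil>) * (1 + D)"
    using T_small_nat[of x y "nat \<lceil>k\<rceil>" p] real_nat_ceiling_ge[of k] by linarith
qed

definition steps :: "real \<Rightarrow> 'a set \<Rightarrow> ('a \<times> 'a) set" where
  "steps k A = {(u, v). u \<in> A \<and> v \<in> A \<and> jump k u v}"

lemma steps_relpow_mem: "(x, y) \<in> steps k A ^^ n \<Longrightarrow> x \<in> A \<Longrightarrow> y \<in> A"
  by (cases n) (auto simp: steps_def)

lemma steps_relpow_commute: "(x, y) \<in> steps k A ^^ n \<Longrightarrow> (y, x) \<in> steps k A ^^ n"
proof (induction n arbitrary: y)
  case (Suc n)
  then obtain z where z: "(x, z) \<in> steps k A ^^ n" "(z, y) \<in> steps k A" by auto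
  have "(y, z) \<in> steps k A" using z(2) jump_commute by (auto simp: steps_def)
  then show ?case using Suc.IH[OF z(1)] by (intro relpow_Suc_I2)
qed auto

text \<open>A jump inside a peripheral set costs one step, however long it is: this is the step count
  of the coned-off space.\<close>

lemma T_near_steps:
  "\<exists>K\<ge>0. \<forall>m n A x y. (x, y) \<in> steps k A ^^ n \<longrightarrow> n \<le> 2 ^ m \<longrightarrow> x \<in> A \<longrightarrow>
     (\<forall>p\<in>T x y. \<exists>a\<in>A. dist p a \<le> D * real m + K)"
proof -
  obtain K where K: "\<forall>P\<in>\<P>. \<forall>x\<in>nbhd k P. \<forall>y\<in>nbhd k P. K \<le> dist x y \<longrightarrow>
      T x y \<subseteq> cball x K \<union> cball y K \<and> T x y \<inter> nbhd D P \<noteq> {}"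
    using T_peripheral by blast
  \<comment> \<open>The bound covers the empty path (0), short steps (\<open>k\<close>), and pairs
    near one peripheral set that are too close together for (6) (\<open>K\<close>).\<close>
  obtain E where E: "0 \<le> E" "\<And>x y p. dist x y \<le> max 0 (max k K) \<Longrightarrow> p \<in> T x y \<Longrightarrow> dist x p \<le> E"
    using T_small[of "max 0 (max k K)"] by blast
  define K1 where "K1 = max E K"
  have one: "\<exists>a\<in>A. dist p a \<le> K1" if J: "jump k x y" and A: "x \<in> A" "y \<in> A" and p: "p \<in> T x y" for A x y p
  proof (cases "dist x y \<le> max 0 (max k K)")
    case True
    then show ?thesis using E(2)[OF _ p] A by (auto simp: K1_def dist_commute intro!: bexI[of _ x])
  next
    case False
    then obtain P where P: "P \<in> \<P>" "x \<in> nbhd k P" "y \<in> nbhd k P" using J by (auto simp: jump_def)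
    have "K \<le> dist x y" using False by auto
    then have "T x y \<subseteq> cball x K \<union> cball y K" using K P by blast
    then have "dist p x \<le> K1 \<or> dist p y \<le> K1" using p by (auto simp: K1_def dist_commute)
    then show ?thesis using A by blast
  qed
  have "\<exists>a\<in>A. dist p a \<le> D * real m + K1"
    if "(x, y) \<in> steps k A ^^ n" "n \<le> 2 ^ m" "x \<in> A" "p \<in> T x y" for m n A x y p
    using that
  proof (induction m arbitrary: n x y p)
    case 0
    then consider "n = 0" | "n = 1" by force
    then show ?case
    proof cases
      case 1
      then have "dist x y \<le> max 0 (max k K)" using 0 by auto
      then show ?thesis using E(2)[of x y p] 0
        by (auto simp: K1_def dist_commute intro!: bexI[of _ x])
    next
      case 2
      then show ?thesis using 0 one[of x y A p] by (auto simp: steps_def)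
    qed
  next
    case (Suc m)
    have n: "n = n div 2 + (n - n div 2)" "n div 2 \<le> 2 ^ m" "n - n div 2 \<le> 2 ^ m" using Suc.prems(2) by auto
    obtain z where z: "(x, z) \<in> steps k A ^^ (n div 2)" "(z, y) \<in> steps k A ^^ (n - n div 2)"
      using Suc.prems(1) n(1) relpow_add[of "n div 2" "n - n div 2" "steps k A"] by (metis relcompE prod.inject)
    have zA: "z \<in> A" using z(1) Suc.prems(3) steps_relpow_mem by blast
    obtain q where q: "q \<in> T x z \<union> T z y" "dist p q \<le> D" using T_triangle Suc.prems by blast
    then obtain a where "a \<in> A" "dist q a \<le> D * real m + K1"
      using Suc.IH[OF z(1) n(2) Suc.prems(3)] Suc.IH[OF z(2) n(3) zA] by blast
    then show ?case using q(2) dist_triangle[of p a q]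
      by (intro bexI[of _ a]) (auto simp: algebra_simps)
  qed
  then show ?thesis using E(1) by (intro exI[of _ K1]) (auto simp: K1_def)
qed

end

section \<open>Coarse projections to peripheral sets\<close>

context guessed_paths
begin

text \<open>The radius leaves room for the later losses: \<open>D\<close> from (6),
  \<open>2 * D\<close> from two uses of (3), \<open>D\<close> from (2), and 1 from uniform
  continuity at the entrance point.\<close>

definition first_in :: "'a set \<Rightarrow> 'a \<Rightarrow> 'a \<Rightarrow> 'a \<Rightarrow> bool" where
  "first_in P x y e \<longleftrightarrow> (\<exists>t\<in>{0..1}. e = \<eta> x y t \<and> e \<in> nbhd (4 * D + 1) P \<and>
     (\<forall>s\<in>{0..<t}. \<eta> x y s \<notin> nbhd (4 * D + 1) P))"

lemma first_in_exists:
  assumes "s \<in> {0..1}" "\<eta> x y s \<in> nbhd (4 * D + 1) P"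
  shows "\<exists>e. first_in P x y e"
proof -
  define S where "S = {0..1} \<inter> \<eta> x y -` nbhd (4 * D + 1) P"
  have "closed S" unfolding S_def
    using continuous_\<eta> closed_nbhd by (intro continuous_closed_preimage) auto
  moreover have "s \<in> S" "0 \<le> s" using assms by (auto simp: S_def)
  ultimately obtain t where t: "t \<in> S" "0 \<le> t" "t \<le> s" "\<forall>u\<in>S. 0 \<le> u \<longrightarrow> t \<le> u"
    by (rule closed_first)
  have "\<eta> x y u \<notin> nbhd (4 * D + 1) P" if "u \<in> {0..<t}" for u
    using t(4) that t(1) by (force simp: S_def)
  then show ?thesis unfolding first_in_def
    using t(1) by (intro exI[of _ "\<eta> x y t"] bexI[of _ t]) (auto simp: S_def)
qed

lemma first_in_self: "first_in P x y e \<Longrightarrow> x \<in> nbhd (4 * D + 1) P \<Longrightarrow> e = x"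
  unfolding first_in_def by (metis \<eta>_0 atLeastAtMost_iff atLeastLessThan_iff order.refl less_eq_real_def)

text \<open>The parameter \<open>t\<close> itself can be included: a point at distance at most
  \<open>4 * D\<close> from \<open>P\<close> would be preceded by one at distance at most
  \<open>4 * D + 1\<close>, or lie that close to the start.\<close>

lemma first_in_before:
  assumes "t \<in> {0..1}" "\<forall>s\<in>{0..<t}. \<eta> x y s \<notin> nbhd (4 * D + 1) P" "x \<notin> nbhd (4 * D + 1) P" "s \<in> {0..t}"
  shows "\<eta> x y s \<notin> nbhd (4 * D) P"
proof
  assume s: "\<eta> x y s \<in> nbhd (4 * D) P"
  obtain d where d: "0 < d"
    "\<And>s t. s \<in> {0..1} \<Longrightarrow> t \<in> {0..1} \<Longrightarrow> \<bar>s - t\<bar> < d \<Longrightarrow> dist (\<eta> x y s) (\<eta> x y t) < 1"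
    using \<eta>_uniform[of 1 x y] by auto
  define u where "u = max 0 (s - d/2)"
  have "u \<in> {0..1}" "\<bar>s - u\<bar> < d" "u \<in> {0..<t} \<or> u = 0"
    using assms d(1) by (auto simp: u_def)
  moreover have "dist (\<eta> x y s) (\<eta> x y u) \<le> 1" using d(2)[of s u] calculation assms by auto
  then have "\<eta> x y u \<in> nbhd (4 * D + 1) P" by (rule nbhd_move[OF s])
  ultimately show False using assms by auto
qed

text \<open>By (2), these transient points are within \<open>D\<close> of the part of
  \<open>\<eta> x y\<close> up to the entrance. As (2) admits its parameters in either order,
  \<open>T x e\<close> and \<open>T e x\<close> are treated alike.\<close>

lemma first_in_far:
  assumes "first_in P x y e" "x \<notin> nbhd (4 * D + 1) P" "p \<in> T x e \<union> T e x"
  shows "p \<notin> nbhd (3 * D) P"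
proof
  assume p: "p \<in> nbhd (3 * D) P"
  obtain t where t: "t \<in> {0..1}" "e = \<eta> x y t" "\<forall>s\<in>{0..<t}. \<eta> x y s \<notin> nbhd (4 * D + 1) P"
    using assms(1) by (auto simp: first_in_def)
  have "\<exists>q\<in>(T x y \<inter> \<eta> x y ` closed_segment 0 t) \<union> {\<eta> x y 0, \<eta> x y t}. dist p q \<le> D"
    using assms(3) T_restrict[of 0 t p x y] T_restrict[of t 0 p x y] t(1,2)
    by (auto simp: closed_segment_commute[of t 0])
  then obtain s where s: "s \<in> {0..t}" "dist p (\<eta> x y s) \<le> D"
    using t(1) by (force simp: closed_segment_eq_real_ivl)
  have "\<eta> x y s \<in> nbhd (3 * D + D) P" by (rule nbhd_move[OF p s(2)])
  then show False using first_in_before[OF t(1,3) assms(2) s(1)] by simp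
qed

text \<open>If two entrance points were far apart, the transient set between them would come close
  to \<open>P\<close>, although it lies near transient sets that stay away from \<open>P\<close>.\<close>

lemma first_in_unique:
  "\<exists>K\<ge>0. \<forall>P\<in>\<P>. \<forall>x y y' e e'. first_in P x y e \<longrightarrow> first_in P x y' e' \<longrightarrow> dist e e' \<le> K"
proof -
  obtain K where K: "\<forall>P\<in>\<P>. \<forall>x\<in>nbhd (4 * D + 1) P. \<forall>y\<in>nbhd (4 * D + 1) P. K \<le> dist x y \<longrightarrow>
      T x y \<subseteq> cball x K \<union> cball y K \<and> T x y \<inter> nbhd D P \<noteq> {}"
    using T_peripheral by blast
  have "dist e e' \<le> max 0 K" if P: "P \<in> \<P>" and e: "first_in P x y e" "first_in P x y' e'" for P x y y' e e'
  proof (rule ccontr)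
    assume far: "\<not> dist e e' \<le> max 0 K"
    have x: "x \<notin> nbhd (4 * D + 1) P" using far first_in_self[OF e(1)] first_in_self[OF e(2)] by auto
    have "e \<in> nbhd (4 * D + 1) P" "e' \<in> nbhd (4 * D + 1) P" using e by (auto simp: first_in_def)
    moreover have "K \<le> dist e e'" using far by auto
    ultimately have "T e e' \<inter> nbhd D P \<noteq> {}" using K P by blast
    then obtain p where p: "p \<in> T e e'" "p \<in> nbhd D P" by blast
    obtain q where q: "q \<in> T e x \<union> T x e'" "dist p q \<le> D" using T_triangle p by blast
    have "q \<in> nbhd (D + D) P" by (rule nbhd_move[OF p(2) q(2)])
    then have "q \<in> nbhd (3 * D) P" using D_ge_1 by (auto elim: nbhd_mono)
    then show False using q first_in_far[OF e(1) x] first_in_far[OF e(2) x] by blast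
  qed
  then show ?thesis by (intro exI[of _ "max 0 K"]) auto
qed

text \<open>By \<open>first_in_unique\<close>, the choice of \<open>q\<close> and of the entrance
  point changes the value by a bounded amount only. The value is meaningful for nonempty
  \<open>P\<close>.\<close>

definition proj :: "'a set \<Rightarrow> 'a \<Rightarrow> 'a" where
  "proj P x = (SOME e. \<exists>q\<in>P. first_in P x q e)"

lemma proj_first_in:
  assumes "P \<noteq> {}"
  obtains q where "q \<in> P" "first_in P x q (proj P x)"
proof -
  obtain q where q: "q \<in> P" using assms by blast
  have "\<eta> x q 1 \<in> nbhd (4 * D + 1) P" using nbhd_memI[OF q, of q] D_ge_1 by auto
  then have "\<exists>e. \<exists>q\<in>P. first_in P x q e" using first_in_exists[of 1 x q P] q by auto
  then have "\<exists>q\<in>P. first_in P x q (proj P x)" unfolding proj_def by (rule someI_ex)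
  then show ?thesis using that by blast
qed

lemma proj_mem: "P \<noteq> {} \<Longrightarrow> proj P x \<in> nbhd (4 * D + 1) P"
  by (metis proj_first_in first_in_def)

lemma proj_self: "x \<in> nbhd (4 * D + 1) P \<Longrightarrow> proj P x = x"
proof -
  assume x: "x \<in> nbhd (4 * D + 1) P"
  then have "P \<noteq> {}" by (auto simp: nbhd_def)
  then obtain q where "first_in P x q (proj P x)" by (rule proj_first_in)
  then show ?thesis using first_in_self x by blast
qed

text \<open>Let \<open>e\<close> be the entrance point of \<open>\<eta> x y\<close>. The first
  parameter in \<open>par x y\<close> from there on is that of \<open>e\<close>, or it ends a gap
  along some \<open>Q\<close>. Then \<open>Q\<close> differs from \<open>P\<close>, since
  \<open>e\<close> is near \<open>Q\<close> but not within \<open>4 * D\<close> of \<open>P\<close>.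
  By (6), \<open>T e y\<close> concentrates near \<open>e\<close> and \<open>y\<close>. If the end
  of the gap is near \<open>y\<close>, then \<open>e\<close> and \<open>y\<close> are near both
  \<open>P\<close> and \<open>Q\<close>, hence near each other by (5).\<close>

lemma T_near_proj:
  "\<exists>E\<ge>0. \<forall>P\<in>\<P>. \<forall>x. \<forall>y\<in>nbhd (4 * D + 1) P. \<exists>p\<in>T x y. dist p (proj P x) \<le> E"
proof -
  obtain K0 where K0: "0 \<le> K0"
    "\<And>P x y y' e e'. P \<in> \<P> \<Longrightarrow> first_in P x y e \<Longrightarrow> first_in P x y' e' \<Longrightarrow> dist e e' \<le> K0"
    using first_in_unique by blast
  obtain K where K: "\<forall>P\<in>\<P>. \<forall>x\<in>nbhd (4 * D + 1) P. \<forall>y\<in>nbhd (4 * D + 1) P. K \<le> dist x y \<longrightarrow>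
      T x y \<subseteq> cball x K \<union> cball y K \<and> T x y \<inter> nbhd D P \<noteq> {}"
    using T_peripheral by blast
  \<comment> \<open>Large enough for \<open>y\<close>, which will be within \<open>1 + D + K\<close>
    of \<open>Q\<close>, and for \<open>e\<close> and \<open>y\<close> as points within
    \<open>4 * D + 1\<close> of \<open>P\<close>.\<close>
  define k where "k = 1 + D + max K 0 + 4 * D + 1"
  have k: "1 \<le> k" "4 * D + 1 \<le> k" "1 + D + K \<le> k" using D_ge_1 by (auto simp: k_def)
  obtain B where B: "\<And>P Q x y. P \<in> \<P> \<Longrightarrow> Q \<in> \<P> \<Longrightarrow> P \<noteq> Q \<Longrightarrow> x \<in> nbhd k P \<Longrightarrow> x \<in> nbhd k Q \<Longrightarrow>
      y \<in> nbhd k P \<Longrightarrow> y \<in> nbhd k Q \<Longrightarrow> dist x y \<le> B"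
    using peripherals_bounded[of k] by (metis Int_iff)
  define E where "E = max 0 (max K B) + 2 * D + K0"
  have main: "\<exists>p\<in>T x y. dist p e \<le> max 0 (max K B) + 2 * D"
    if P: "P \<in> \<P>" and y: "y \<in> nbhd (4 * D + 1) P" and e: "first_in P x y e" for P x y e
  proof -
    obtain px where px: "px \<in> T x y" "dist x px \<le> D" using T_start by blast
    obtain py where py: "py \<in> T x y" "dist y py \<le> D" using T_finish by blast
    have ynear: ?thesis if "dist e y \<le> max 0 (max K B)"
      using py that dist_triangle[of py e y] D_ge_1
      by (intro bexI[of _ py]) (auto simp: dist_commute)
    show ?thesis
    proof (cases "x \<in> nbhd (4 * D + 1) P")
      case True
      then have "e = x" using first_in_self e by blast
      then show ?thesis using px D_ge_1 by (intro bexI[of _ px]) (auto simp: dist_commute)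
    next
      case False
      obtain t where t: "t \<in> {0..1}" "e = \<eta> x y t" "e \<in> nbhd (4 * D + 1) P"
          "\<forall>s\<in>{0..<t}. \<eta> x y s \<notin> nbhd (4 * D + 1) P"
        using e by (auto simp: first_in_def)
      have e1: "e \<notin> nbhd (4 * D) P" using first_in_before[OF t(1,4) False, of t] t by auto
      have "1 \<in> par x y" "t \<le> 1" using t(1) by (auto simp: par_def)
      then obtain v where v: "v \<in> par x y" "t \<le> v" "v \<le> 1"
          and v_first: "\<forall>u\<in>par x y. t \<le> u \<longrightarrow> v \<le> u"
        by (rule closed_first[OF closed_par])
      obtain pv where pv: "pv \<in> T x y" "dist (\<eta> x y v) pv \<le> D" using par_T[OF v(1)] by blast
      have vnear: ?thesis if "dist e (\<eta> x y v) \<le> D + max 0 (max K B)"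
        using pv that dist_triangle[of e pv "\<eta> x y v"]
        by (intro bexI[of _ pv]) (auto simp: dist_commute)
      show ?thesis
      proof (cases "v = t")
        case True
        then show ?thesis using vnear t D_ge_1 by auto
      next
        case False
        have "par x y \<inter> {t<..<v} = {}" using v_first by force
        then obtain Q where Q: "Q \<in> \<P>" "e \<in> nbhd 1 Q" "\<eta> x y v \<in> nbhd 1 Q"
          using gap_peripheral[of t v x y] t v False by auto
        have PQ: "P \<noteq> Q" using e1 Q(2) D_ge_1 nbhd_mono[of e 1 Q "4 * D"] by auto
        show ?thesis
        proof (cases "K \<le> dist e y")
          case False
          then show ?thesis using ynear by auto
        next
          case True
          then have sub: "T e y \<subseteq> cball e K \<union> cball y K" using K P y t(3) by blast
          have "\<eta> x y v \<in> (T x y \<inter> \<eta> x y ` closed_segment t 1) \<union> {\<eta> x y t, \<eta> x y 1}"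
            using v t by (auto simp: closed_segment_eq_real_ivl par_def)
          then obtain p where p: "p \<in> T e y" "dist (\<eta> x y v) p \<le> D"
            using T_extend[of t 1 "\<eta> x y v" x y] t by auto
          then consider "dist e p \<le> K" | "dist y p \<le> K" using sub by auto
          then show ?thesis
          proof cases
            case 1
            then show ?thesis using vnear p(2) dist_triangle[of e "\<eta> x y v" p]
              by (auto simp: dist_commute)
          next
            case 2
            then have "dist (\<eta> x y v) y \<le> D + K"
              using p(2) dist_triangle[of "\<eta> x y v" y p] by (auto simp: dist_commute)
            then have "y \<in> nbhd (1 + (D + K)) Q" by (rule nbhd_move[OF Q(3)])
            then have "y \<in> nbhd k Q" "e \<in> nbhd k Q" "y \<in> nbhd k P" "e \<in> nbhd k P"
              using k y t(3) Q(2) by (auto elim!: nbhd_mono)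
            then have "dist e y \<le> B" using B[OF P Q(1) PQ] by blast
            then show ?thesis using ynear by auto
          qed
        qed
      qed
    qed
  qed
  have "\<exists>p\<in>T x y. dist p (proj P x) \<le> E" if P: "P \<in> \<P>" and y: "y \<in> nbhd (4 * D + 1) P" for P x y
  proof -
    have "P \<noteq> {}" using y by (auto simp: nbhd_def)
    then obtain q where q: "first_in P x q (proj P x)" by (rule proj_first_in)
    obtain e where e: "first_in P x y e" using first_in_exists[of 1 x y P] y by auto
    obtain p where "p \<in> T x y" "dist p e \<le> max 0 (max K B) + 2 * D" using main[OF P y e] by blast
    then show ?thesis using K0(2)[OF P e q] dist_triangle[of p "proj P x" e]
      by (intro bexI[of _ p]) (auto simp: E_def)
  qed
  moreover have "0 \<le> E" using K0 D_ge_1 by (auto simp: E_def)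
  ultimately show ?thesis by blast
qed

text \<open>Between far projections, (6) gives a transient point close to \<open>P\<close>. Two uses
  of (3) move it to one of three transient sets; those joining \<open>x\<close> and \<open>y\<close>
  to their projections avoid \<open>P\<close>, so it ends up on \<open>T x y\<close>. Cutting
  \<open>\<eta> x y\<close> at this point, which is near \<open>P\<close>, reduces both claims to
  \<open>T_near_proj\<close>.\<close>

lemma T_passes_proj:
  "\<exists>E\<ge>0. \<forall>P\<in>\<P>. \<forall>x y. P \<noteq> {} \<longrightarrow> E < dist (proj P x) (proj P y) \<longrightarrow>
     (\<exists>p\<in>T x y. dist p (proj P x) \<le> E) \<and> (\<exists>p\<in>T x y. dist p (proj P y) \<le> E)"
proof -
  obtain E0 where E0: "0 \<le> E0"
    "\<And>P x y. P \<in> \<P> \<Longrightarrow> y \<in> nbhd (4 * D + 1) P \<Longrightarrow> \<exists>p\<in>T x y. dist p (proj P x) \<le> E0"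
    using T_near_proj by blast
  obtain K where K: "\<forall>P\<in>\<P>. \<forall>x\<in>nbhd (4 * D + 1) P. \<forall>y\<in>nbhd (4 * D + 1) P. K \<le> dist x y \<longrightarrow>
      T x y \<subseteq> cball x K \<union> cball y K \<and> T x y \<inter> nbhd D P \<noteq> {}"
    using T_peripheral by blast
  define E where "E = max K 0 + E0 + 3 * D"
  have EE: "E0 + 2 * D \<le> E" "E0 \<le> E" "D \<le> E" "0 \<le> E" using E0 D_ge_1 by (auto simp: E_def)
  have comm: "\<exists>p\<in>T u v. dist p c \<le> E" if ex: "\<exists>p\<in>T v u. dist p c \<le> E0" for u v c
  proof -
    obtain p where p: "p \<in> T v u" "dist p c \<le> E0" using ex by blast
    obtain q where "q \<in> T u v" "dist p q \<le> 2 * D" using T_commute p by blast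
    then show ?thesis using p EE dist_triangle[of q c p]
      by (intro bexI[of _ q]) (auto simp: dist_commute)
  qed
  have "(\<exists>p\<in>T x y. dist p (proj P x) \<le> E) \<and> (\<exists>p\<in>T x y. dist p (proj P y) \<le> E)"
    if P: "P \<in> \<P>" "P \<noteq> {}" and far: "E < dist (proj P x) (proj P y)" for P x y
  proof -
    obtain px where px: "px \<in> T x y" "dist x px \<le> D" using T_start by blast
    obtain py where py: "py \<in> T x y" "dist y py \<le> D" using T_finish by blast
    show ?thesis
    proof (cases "x \<in> nbhd (4 * D + 1) P")
      case True
      then have "proj P x = x" by (rule proj_self)
      moreover have "\<exists>p\<in>T x y. dist p (proj P y) \<le> E" using E0(2)[OF P(1) True] by (rule comm)
      moreover have "dist px x \<le> E" using px(2) EE by (simp add: dist_commute)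
      ultimately show ?thesis using px(1) by metis
    next
      case x: False
      show ?thesis
      proof (cases "y \<in> nbhd (4 * D + 1) P")
        case True
        then have "proj P y = y" by (rule proj_self)
        moreover obtain p where "p \<in> T x y" "dist p (proj P x) \<le> E0" using E0(2)[OF P(1) True] by blast
        moreover have "dist py y \<le> E" using py(2) EE by (simp add: dist_commute)
        ultimately show ?thesis using py(1) EE(2) by (metis order_trans)
      next
        case y: False
        obtain q where fx: "first_in P x q (proj P x)" using P(2) by (rule proj_first_in)
        obtain q' where fy: "first_in P y q' (proj P y)" using P(2) by (rule proj_first_in)
        have "K \<le> dist (proj P x) (proj P y)" using far E0 D_ge_1 by (auto simp: E_def)
        then have "T (proj P x) (proj P y) \<inter> nbhd D P \<noteq> {}" using K P proj_mem[OF P(2)] by blast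
        then obtain z where z: "z \<in> T (proj P x) (proj P y)" "z \<in> nbhd D P" by blast
        obtain w where w: "w \<in> T (proj P x) x \<union> T x (proj P y)" "dist z w \<le> D" using T_triangle z by blast
        have w2: "w \<in> nbhd (D + D) P" by (rule nbhd_move[OF z(2) w(2)])
        then have "w \<notin> T (proj P x) x" using first_in_far[OF fx x, of w] nbhd_mono[OF w2, of "3 * D"] D_ge_1 by auto
        then obtain p where p: "p \<in> T x y \<union> T y (proj P y)" "dist w p \<le> D" using T_triangle w by blast
        have "p \<in> nbhd (D + D + D) P" by (rule nbhd_move[OF w2 p(2)])
        then have p3: "p \<in> nbhd (3 * D) P" by simp
        then have pT: "p \<in> T x y" using p first_in_far[OF fy y, of p] by auto
        obtain s where s: "s \<in> par x y" "p = \<eta> x y s" using pT by (rule T_parE)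
        have s01: "s \<in> {0..1}" using s par_subset by blast
        have pk: "p \<in> nbhd (4 * D + 1) P" using p3 D_ge_1 by (auto elim: nbhd_mono)
        \<comment> \<open>(2) leads from the transient set of one piece back to
          \<open>T x y\<close>, with a further \<open>D\<close> if it leads to an end of the
          path.\<close>
        have seg: "\<exists>p'\<in>T x y. dist p' c \<le> E"
          if r: "r \<in> {0, 1}" and a: "a \<in> T (\<eta> x y r) p" "dist a c \<le> E0" for a c r
        proof -
          obtain b where b0: "b \<in> (T x y \<inter> \<eta> x y ` closed_segment r s) \<union> {\<eta> x y r, \<eta> x y s}" and
              b: "dist a b \<le> D"
          proof -
            have "r \<in> {0..1}" "a \<in> T (\<eta> x y r) (\<eta> x y s)" using r a(1) s(2) by auto
            then show thesis using T_restrict[OF _ s01, of r a x y] that by blast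
          qed
          have b1: "b \<in> T x y \<union> {x, y, p}" using b0 r s by auto
          have "\<exists>p'\<in>T x y. dist b p' \<le> D"
            using b1 px py pT D_ge_1 by (auto intro: bexI[of _ b])
          then obtain p' where "p' \<in> T x y" "dist b p' \<le> D" by blast
          then show ?thesis using a(2) b EE dist_triangle[of p' c b] dist_triangle[of b c a]
            by (intro bexI[of _ p']) (auto simp: dist_commute)
        qed
        obtain a where "a \<in> T x p" "dist a (proj P x) \<le> E0" using E0(2)[OF P(1) pk] by blast
        moreover obtain a' where "a' \<in> T y p" "dist a' (proj P y) \<le> E0" using E0(2)[OF P(1) pk] by blast
        ultimately show ?thesis using seg[of 0 a] seg[of 1 a'] by auto
      qed
    qed
  qed
  then show ?thesis using EE by (intro exI[of _ E]) blast
qed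

text \<open>Over a unit distance, two far projections would both be near \<open>T x y\<close>, which
  has bounded size. Unit pieces of a geodesic give the rest.\<close>

lemma proj_lipschitz:
  "\<exists>E\<ge>0. \<forall>P\<in>\<P>. \<forall>x y. P \<noteq> {} \<longrightarrow> dist (proj P x) (proj P y) \<le> E * (dist x y + 1)"
proof -
  obtain E1 where E1: "0 \<le> E1" "\<forall>P\<in>\<P>. \<forall>x y. P \<noteq> {} \<longrightarrow> E1 < dist (proj P x) (proj P y) \<longrightarrow>
     (\<exists>p\<in>T x y. dist p (proj P x) \<le> E1) \<and> (\<exists>p\<in>T x y. dist p (proj P y) \<le> E1)"
    using T_passes_proj by (elim exE conjE)
  obtain E2 where E2: "0 \<le> E2" "\<And>x y p. dist x y \<le> 1 \<Longrightarrow> p \<in> T x y \<Longrightarrow> dist x p \<le> E2"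
    using T_small[of 1] by blast
  define E where "E = 2 * E1 + 2 * E2"
  have one: "dist (proj P x) (proj P y) \<le> E" if short: "P \<in> \<P>" "P \<noteq> {}" "dist x y \<le> 1" for P x y
  proof (cases "E1 < dist (proj P x) (proj P y)")
    case True
    then obtain p q where "p \<in> T x y" "dist p (proj P x) \<le> E1" "q \<in> T x y" "dist q (proj P y) \<le> E1"
      using E1(2)[rule_format, OF short(1,2) True] by blast
    then show ?thesis
      using E2(2)[OF short(3), of p] E2(2)[OF short(3), of q] dist_triangle[of "proj P x" "proj P y" p]
        dist_triangle[of p "proj P y" q] dist_triangle[of p q x]
      by (auto simp: E_def dist_commute)
  qed (use E1 E2 in \<open>auto simp: E_def\<close>)
  have nat: "dist (proj P x) (proj P y) \<le> E * real n" if "P \<in> \<P>" "P \<noteq> {}" "dist x y \<le> real n" for P x y n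
    using that(3)
  proof (induction n arbitrary: x)
    case (Suc n)
    show ?case
    proof (cases "dist x y \<le> 1")
      case True
      have "E * 1 \<le> E * real (Suc n)" using E1 E2 by (intro mult_left_mono) (auto simp: E_def)
      then show ?thesis using one[OF that(1,2) True] by auto
    next
      case False
      obtain g where g: "g 0 = x" "g (dist x y) = y"
        "\<And>s t. s \<in> {0..dist x y} \<Longrightarrow> t \<in> {0..dist x y} \<Longrightarrow> dist (g s) (g t) = \<bar>s - t\<bar>"
        using geodesicE by blast
      have "dist x (g 1) \<le> 1" "dist (g 1) y \<le> real n"
        using g(3)[of 0 1] g(3)[of 1 "dist x y"] g(1,2) False Suc.prems by auto
      then show ?thesis using one[OF that(1,2), of x "g 1"] Suc.IH[of "g 1"]
          dist_triangle[of "proj P x" "proj P y" "proj P (g 1)"] by (auto simp: algebra_simps)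
    qed
  qed auto
  have "dist (proj P x) (proj P y) \<le> E * (dist x y + 1)" if "P \<in> \<P>" "P \<noteq> {}" for P x y
  proof -
    have "dist (proj P x) (proj P y) \<le> E * real (nat \<lceil>dist x y\<rceil>)"
      using nat[OF that] real_nat_ceiling_ge by blast
    also have "\<dots> \<le> E * (dist x y + 1)" using E1 E2
      by (intro mult_left_mono) (auto simp: E_def)
    finally show ?thesis .
  qed
  then show ?thesis using E1 E2 by (intro exI[of _ E]) (auto simp: E_def)
qed

text \<open>A point of \<open>P\<close> at distance less than \<open>r + 1\<close> from
  \<open>x\<close> is its own projection, so the Lipschitz bound can be applied to it and
  \<open>x\<close>.\<close>

lemma dist_proj:
  "\<exists>E\<ge>1. \<forall>P\<in>\<P>. \<forall>x r. 0 \<le> r \<longrightarrow> x \<in> nbhd r P \<longrightarrow> dist x (proj P x) \<le> E * (r + 1)"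
proof -
  obtain E where E: "0 \<le> E" "\<And>P x y. P \<in> \<P> \<Longrightarrow> P \<noteq> {} \<Longrightarrow> dist (proj P x) (proj P y) \<le> E * (dist x y + 1)"
    using proj_lipschitz by blast
  have "dist x (proj P x) \<le> (1 + 2 * E) * (r + 1)" if P: "P \<in> \<P>" and r: "0 \<le> r" and x: "x \<in> nbhd r P" for P x r
  proof -
    obtain q where q: "q \<in> P" "dist x q < r + 1" using nbhd_memE[OF x, of "r + 1"] by auto
    have "proj P q = q" using nbhd_memI[OF q(1), of q] D_ge_1 by (intro proj_self) auto
    moreover have "dist (proj P q) (proj P x) \<le> E * (dist q x + 1)" using E(2) P q(1) by blast
    moreover have "E * (dist q x + 1) \<le> E * (2 * (r + 1))"
      using E(1) q(2) r by (intro mult_left_mono) (auto simp: dist_commute)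
    ultimately have "dist q (proj P x) \<le> E * (2 * (r + 1))" by simp
    then show ?thesis using q(2) dist_triangle[of x "proj P x" q] by (simp add: algebra_simps)
  qed
  then show ?thesis using E(1) by (intro exI[of _ "1 + 2 * E"]) auto
qed

end

section \<open>Almost-geodesics and peripheral sets\<close>

lemma quasi_geodesicD:
  assumes "quasi_geodesic 1 C \<beta> a b" "s \<in> {a..b}" "t \<in> {a..b}"
  shows "\<bar>s - t\<bar> - C \<le> dist (\<beta> s) (\<beta> t)" "dist (\<beta> s) (\<beta> t) \<le> \<bar>s - t\<bar> + C"
  using assms by (auto simp: quasi_geodesic_def)

lemma quasi_geodesic_sub:
  "quasi_geodesic K C \<beta> a b \<Longrightarrow> a \<le> s \<Longrightarrow> s \<le> t \<Longrightarrow> t \<le> b \<Longrightarrow> quasi_geodesic K C \<beta> s t"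
  by (auto simp: quasi_geodesic_def)

lemma almost_geodesic_sub:
  "almost_geodesic K C \<beta> a b \<Longrightarrow> a \<le> s \<Longrightarrow> s \<le> t \<Longrightarrow> t \<le> b \<Longrightarrow> almost_geodesic K C \<beta> s t"
  by (auto simp: almost_geodesic_def elim: quasi_geodesic_sub continuous_on_subset)

context guessed_paths
begin

section \<open>Step counts along paths, and contraction of projections\<close>

lemma steps_quasi_geodesic:
  assumes "quasi_geodesic 1 C \<beta> a b" "s \<in> {a..b}" "t \<in> {a..b}" "\<bar>s - t\<bar> \<le> real n" "1 + C \<le> k"
    "\<beta> ` closed_segment s t \<subseteq> A"
  shows "(\<beta> s, \<beta> t) \<in> steps k A ^^ n"
proof (cases "n = 0")
  case False
  define f where "f i = s + (real i / real n) * (t - s)" for i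
  have seg: "f i \<in> closed_segment s t" if "i \<le> n" for i
    unfolding closed_segment_def f_def using that False
    by (auto intro!: exI[of _ "real i / real n"] simp: algebra_simps diff_divide_distrib)
  then have ab: "f i \<in> {a..b}" if "i \<le> n" for i
    using that assms(2,3) by (force simp: closed_segment_eq_real_ivl split: if_splits)
  have "(\<beta> (f i), \<beta> (f (Suc i))) \<in> steps k A" if "i < n" for i
  proof -
    have "f (Suc i) - f i = (t - s) / real n" by (simp add: f_def algebra_simps add_divide_distrib diff_divide_distrib)
    then have "\<bar>f i - f (Suc i)\<bar> \<le> 1" using assms(4) False
      by (simp add: abs_minus_commute[of "f i"] abs_divide abs_minus_commute[of t])
    then have "dist (\<beta> (f i)) (\<beta> (f (Suc i))) \<le> k"
      using quasi_geodesicD(2)[OF assms(1) ab ab, of i "Suc i"] that assms(5) by auto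
    then show ?thesis using seg[of i] seg[of "Suc i"] that assms(6) by (auto simp: steps_def jump_def)
  qed
  moreover have "f 0 = s" "f n = t" using False by (auto simp: f_def)
  ultimately show ?thesis unfolding relpow_fun_conv by (intro exI[of _ "\<lambda>i. \<beta> (f i)"]) auto
qed (use assms(4) in auto)

lemma steps_geodesic:
  assumes "dist x y \<le> real n" "1 \<le> k" "cball x (dist x y) \<subseteq> A"
  shows "(x, y) \<in> steps k A ^^ n"
proof -
  obtain g where g: "g 0 = x" "g (dist x y) = y"
    "\<And>s t. s \<in> {0..dist x y} \<Longrightarrow> t \<in> {0..dist x y} \<Longrightarrow> dist (g s) (g t) = \<bar>s - t\<bar>"
    using geodesicE by blast
  have "quasi_geodesic 1 0 g 0 (dist x y)" using g(3) by (simp add: quasi_geodesic_def)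
  moreover have "g ` closed_segment 0 (dist x y) \<subseteq> A"
  proof -
    have "dist x (g t) \<le> dist x y" if "t \<in> {0..dist x y}" for t
      using g(3)[of 0 t] g(1) that by auto
    then show ?thesis using assms(3) by (auto simp: closed_segment_eq_real_ivl)
  qed
  ultimately show ?thesis
    using steps_quasi_geodesic[of 0 g 0 "dist x y" 0 "dist x y" n k A] assms g(1,2) by auto
qed

text \<open>Far projections would force \<open>T x y\<close> to come near \<open>proj P x\<close>,
  hence near \<open>P\<close>; but it stays within a logarithmic distance of \<open>A\<close>, which
  avoids that neighbourhood of \<open>P\<close>.\<close>

lemma proj_contracts:
  "\<exists>c>0. \<forall>P\<in>\<P>. \<forall>m n A x y. P \<noteq> {} \<longrightarrow> (x, y) \<in> steps k A ^^ n \<longrightarrow> n \<le> 2 ^ m \<longrightarrow> x \<in> A \<longrightarrow>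
     A \<inter> nbhd (D * real m + c) P = {} \<longrightarrow> dist (proj P x) (proj P y) \<le> c"
proof -
  obtain E where E: "0 \<le> E" "\<forall>P\<in>\<P>. \<forall>x y. P \<noteq> {} \<longrightarrow> E < dist (proj P x) (proj P y) \<longrightarrow>
     (\<exists>p\<in>T x y. dist p (proj P x) \<le> E) \<and> (\<exists>p\<in>T x y. dist p (proj P y) \<le> E)"
    using T_passes_proj by (elim exE conjE)
  obtain K where K: "0 \<le> K" "\<And>m n A x y p. (x, y) \<in> steps k A ^^ n \<Longrightarrow> n \<le> 2 ^ m \<Longrightarrow> x \<in> A \<Longrightarrow>
     p \<in> T x y \<Longrightarrow> \<exists>a\<in>A. dist p a \<le> D * real m + K"
    using T_near_steps[of k] by metis
  define c where "c = 4 * D + 1 + E + K"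
  have "dist (proj P x) (proj P y) \<le> c"
    if P: "P \<in> \<P>" "P \<noteq> {}" and st: "(x, y) \<in> steps k A ^^ n" "n \<le> 2 ^ m" "x \<in> A"
      and A: "A \<inter> nbhd (D * real m + c) P = {}" for P m n A x y
  proof (rule ccontr)
    assume "\<not> dist (proj P x) (proj P y) \<le> c"
    then have "E < dist (proj P x) (proj P y)" using D_ge_1 K(1) by (auto simp: c_def)
    then obtain p where p: "p \<in> T x y" "dist p (proj P x) \<le> E" using E(2) P by blast
    obtain a where a: "a \<in> A" "dist p a \<le> D * real m + K" using K(2)[OF st p(1)] by blast
    have "dist (proj P x) a \<le> E + (D * real m + K)"
      using p(2) a(2) dist_triangle[of "proj P x" a p] by (auto simp: dist_commute)
    then have "a \<in> nbhd (4 * D + 1 + (E + (D * real m + K))) P"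
      by (rule nbhd_move[OF proj_mem[OF P(2)]])
    then have "a \<in> nbhd (D * real m + c) P" by (simp add: c_def algebra_simps)
    then show False using A a(1) by blast
  qed
  moreover have "0 < c" using E K D_ge_1 by (auto simp: c_def)
  ultimately show ?thesis by (intro exI[of _ c]) blast
qed

text \<open>A piece of length \<open>L\<close> moves the projection by at most \<open>c\<close>, a
  contraction by \<open>c / L\<close>. The neighbourhood to be avoided need grow only with the
  logarithm of \<open>L\<close>, so the factor can be made small cheaply. The summand 1 rounds up
  the number of pieces.\<close>

lemma proj_along_quasi_geodesic:
  assumes "0 \<le> C"
  shows "\<exists>c>0. \<forall>P\<in>\<P>. \<forall>\<beta> a b m L. P \<noteq> {} \<longrightarrow> quasi_geodesic 1 C \<beta> a b \<longrightarrow> 1 \<le> L \<longrightarrow> L \<le> 2 ^ m \<longrightarrow>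
     (\<forall>t\<in>{a..b}. \<beta> t \<notin> nbhd (D * real m + c) P) \<longrightarrow>
     dist (proj P (\<beta> a)) (proj P (\<beta> b)) \<le> c * ((b - a) / real L + 1)"
proof -
  obtain c where c: "0 < c" "\<And>P m n A x y. P \<in> \<P> \<Longrightarrow> P \<noteq> {} \<Longrightarrow> (x, y) \<in> steps (1 + C) A ^^ n \<Longrightarrow> n \<le> 2 ^ m \<Longrightarrow>
     x \<in> A \<Longrightarrow> A \<inter> nbhd (D * real m + c) P = {} \<Longrightarrow> dist (proj P x) (proj P y) \<le> c"
    using proj_contracts[of "1 + C"] by metis
  have "dist (proj P (\<beta> a)) (proj P (\<beta> b)) \<le> c * ((b - a) / real L + 1)"
    if P: "P \<in> \<P>" "P \<noteq> {}" and q: "quasi_geodesic 1 C \<beta> a b" and L: "1 \<le> L" "L \<le> 2 ^ m"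
      and far: "\<forall>t\<in>{a..b}. \<beta> t \<notin> nbhd (D * real m + c) P" for P \<beta> a b m and L :: nat
  proof -
    have ab: "a \<le> b" using q by (simp add: quasi_geodesic_def)
    have pieces: "dist (proj P (\<beta> a)) (proj P (\<beta> u)) \<le> c * real N" if "u \<in> {a..b}" "u - a \<le> real N * real L" for N u
      using that
    proof (induction N arbitrary: u)
      case (Suc N)
      define v where "v = max a (u - real L)"
      have v: "v \<in> {a..b}" "v - a \<le> real N * real L" "\<bar>v - u\<bar> \<le> real L" "v \<le> u"
        using Suc.prems by (auto simp: v_def algebra_simps)
      have sub: "\<beta> ` closed_segment v u \<subseteq> \<beta> ` {a..b}"
        using v Suc.prems by (intro image_mono) (auto simp: closed_segment_eq_real_ivl)
      have "(\<beta> v, \<beta> u) \<in> steps (1 + C) (\<beta> ` {a..b}) ^^ L"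
        by (rule steps_quasi_geodesic[OF q v(1) Suc.prems(1) v(3) order.refl sub])
      then have "dist (proj P (\<beta> v)) (proj P (\<beta> u)) \<le> c"
        by (rule c(2)[OF P _ L(2)]) (use v far in auto)
      then show ?case using Suc.IH[OF v(1,2)] dist_triangle[of "proj P (\<beta> a)" "proj P (\<beta> u)" "proj P (\<beta> v)"]
        by (auto simp: algebra_simps)
    qed auto
    have len: "b - a \<le> real (nat \<lceil>(b - a) / real L\<rceil>) * real L"
      using real_nat_ceiling_ge[of "(b - a) / real L"] L(1) by (simp add: divide_le_eq)
    have "dist (proj P (\<beta> a)) (proj P (\<beta> b)) \<le> c * real (nat \<lceil>(b - a) / real L\<rceil>)"
      by (rule pieces[OF _ len]) (use ab in auto)
    also have "\<dots> \<le> c * ((b - a) / real L + 1)"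
      using c(1) ab by (intro mult_left_mono) auto
    finally show ?thesis .
  qed
  then show ?thesis using c(1) by blast
qed

lemma alpha2_peripherals: "alpha2 \<P>"
proof -
  obtain c where c: "0 < c" "\<And>P \<beta> a b m L. P \<in> \<P> \<Longrightarrow> P \<noteq> {} \<Longrightarrow> quasi_geodesic 1 0 \<beta> a b \<Longrightarrow> 1 \<le> L \<Longrightarrow> L \<le> 2 ^ m \<Longrightarrow>
     (\<forall>t\<in>{a..b}. \<beta> t \<notin> nbhd (D * real m + c) P) \<Longrightarrow>
     dist (proj P (\<beta> a)) (proj P (\<beta> b)) \<le> c * ((b - a) / real L + 1)"
    using proj_along_quasi_geodesic[of 0] by (metis order.refl)
  obtain E where E: "1 \<le> E" "\<And>P x r. P \<in> \<P> \<Longrightarrow> 0 \<le> r \<Longrightarrow> x \<in> nbhd r P \<Longrightarrow> dist x (proj P x) \<le> E * (r + 1)"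
    using dist_proj by metis
  \<comment> \<open>\<open>L >= 4 * c\<close> brings the projections to within a quarter of the
    distance, up to \<open>c\<close>. As \<open>L\<close> is fixed, the crude depth
    \<open>L <= 2 ^ L\<close> suffices.\<close>
  define L where "L = nat \<lceil>4 * c\<rceil>"
  have L1: "4 * c \<le> real L" unfolding L_def by (rule real_nat_ceiling_ge)
  then have "0 < real L" using c(1) by linarith
  then have L: "4 * c \<le> real L" "1 \<le> L" "L \<le> 2 ^ L" using L1 by (auto simp: less_imp_le)
  \<comment> \<open>Let d be \<open>dist x y\<close>. If the geodesic misses
    \<open>nbhd M P\<close>, the projections are at most \<open>d/4 + c\<close> apart and the ends
    within \<open>d/8 + E\<close> of them, so d is at most \<open>4 * E + 2 * c\<close>, which is
    less than \<open>M\<close>; but the end \<open>x\<close> outside \<open>nbhd M P\<close> forces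
    \<open>M < \<epsilon> * d\<close>.\<close>
  define M where "M = D * real L + c + 4 * E + 2 * c"
  define \<epsilon> where "\<epsilon> = 1 / (8 * E)"
  have \<epsilon>: "0 < \<epsilon>" "\<epsilon> \<le> 1/8" "E * \<epsilon> = 1/8" using E(1) by (auto simp: \<epsilon>_def field_simps)
  have DL: "0 \<le> D * real L" using D_ge_1 by auto
  have "\<gamma> ` {a..b} \<inter> nbhd M P \<noteq> {}"
    if P: "P \<in> \<P>" and xy: "x \<in> nbhd (\<epsilon> * dist x y) P" "y \<in> nbhd (\<epsilon> * dist x y) P"
      and g: "geodesic \<gamma> a b" "\<gamma> a = x" "\<gamma> b = y" for P x y \<gamma> a b
  proof
    assume miss: "\<gamma> ` {a..b} \<inter> nbhd M P = {}"
    have ab: "a \<le> b" and d: "dist x y = b - a" using g by (auto simp: geodesic_def)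
    have q: "quasi_geodesic 1 0 \<gamma> a b" using g(1) by (auto simp: quasi_geodesic_def geodesic_def)
    have P0: "P \<noteq> {}" using xy by (auto simp: nbhd_def)
    have "x \<notin> nbhd M P" using miss g(2) ab by force
    then have M: "M < \<epsilon> * dist x y" using nbhd_mono[OF xy(1), of M] by force
    have "D * real L + c \<le> M" using c(1) E(1) by (simp add: M_def)
    then have "nbhd (D * real L + c) P \<subseteq> nbhd M P" using nbhd_mono by blast
    then have "\<forall>t\<in>{a..b}. \<gamma> t \<notin> nbhd (D * real L + c) P" using miss by blast
    then have "dist (proj P x) (proj P y) \<le> c * (dist x y / real L + 1)"
      using c(2)[OF P P0 q L(2,3)] g d by auto
    also have "\<dots> \<le> dist x y / 4 + c"
    proof -
      have "c * dist x y \<le> dist x y / 4 * real L" using mult_right_mono[OF L(1), of "dist x y"] by (simp add: mult_ac)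
      then have "c * dist x y / real L \<le> dist x y / 4" using L(2) by (subst pos_divide_le_eq) auto
      then show ?thesis by (simp add: distrib_left)
    qed
    finally have proj_xy: "dist (proj P x) (proj P y) \<le> dist x y / 4 + c" .
    have "E * (\<epsilon> * dist x y + 1) = dist x y / 8 + E"
      using \<epsilon>(3) by (simp add: distrib_left mult.assoc[symmetric])
    moreover have "0 \<le> \<epsilon> * dist x y" using \<epsilon>(1) by simp
    ultimately have "dist x (proj P x) \<le> dist x y / 8 + E" "dist y (proj P y) \<le> dist x y / 8 + E"
      using E(2)[OF P _ xy(1)] E(2)[OF P _ xy(2)] by metis+
    moreover have "dist x y \<le> dist x (proj P x) + dist (proj P x) (proj P y) + dist y (proj P y)"
      by (smt (verit) dist_commute dist_triangle)
    ultimately have "dist x y \<le> 4 * E + 2 * c" using proj_xy by linarith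
    moreover have "\<epsilon> * dist x y \<le> 1/8 * dist x y" using \<epsilon>(2) by (intro mult_right_mono) auto
    ultimately show False using M DL c(1) E(1) unfolding M_def by linarith
  qed
  moreover have "\<epsilon> < 1/2" "0 \<le> M" using \<epsilon> DL c(1) E(1) by (auto simp: M_def)
  ultimately show ?thesis unfolding alpha2_def using \<epsilon>(1) by blast
qed

text \<open>On an excursion out of \<open>nbhd r P\<close> the projection is contracted by one half,
  up to a constant, while the ends are within O(r) of their projections; so the excursion has length
  O(r). The bound \<open>l * r\<close>, rather than an arbitrary function of \<open>r\<close>, keeps
  the detours in \<open>escape\<close> at O(r) steps.\<close>

lemma peripheral_quasiconvex:
  assumes "0 \<le> C"
  shows "\<exists>l\<ge>1. \<exists>r0\<ge>1. \<forall>r\<ge>r0. \<forall>P\<in>\<P>. \<forall>\<beta> a b. almost_geodesic 1 C \<beta> a b \<longrightarrow>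
     \<beta> a \<in> nbhd r P \<longrightarrow> \<beta> b \<in> nbhd r P \<longrightarrow> (\<forall>u\<in>{a..b}. \<beta> u \<in> nbhd (l * r) P)"
proof -
  obtain c where c: "0 < c" "\<And>P \<beta> a b m L. P \<in> \<P> \<Longrightarrow> P \<noteq> {} \<Longrightarrow> quasi_geodesic 1 C \<beta> a b \<Longrightarrow> 1 \<le> L \<Longrightarrow> L \<le> 2 ^ m \<Longrightarrow>
     (\<forall>t\<in>{a..b}. \<beta> t \<notin> nbhd (D * real m + c) P) \<Longrightarrow>
     dist (proj P (\<beta> a)) (proj P (\<beta> b)) \<le> c * ((b - a) / real L + 1)"
    using proj_along_quasi_geodesic[OF assms] by metis
  obtain E where E: "1 \<le> E" "\<And>P x r. P \<in> \<P> \<Longrightarrow> 0 \<le> r \<Longrightarrow> x \<in> nbhd r P \<Longrightarrow> dist x (proj P x) \<le> E * (r + 1)"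
    using dist_proj by metis
  obtain r1 where r1: "1 \<le> r1" "\<And>r. r1 \<le> r \<Longrightarrow> \<exists>m::nat. (c + 2) * r \<le> 2 ^ m \<and> D * m + (c + 2) < r / 2"
    using log_bound[of D "c + 2"] D_ge_1 c(1) by auto
  define l where "l = 3 + 3 * C + 2 * c + 4 * E * (3 + C)"
  have "\<beta> u \<in> nbhd (l * r) P"
    if r: "max r1 (2 * c) \<le> r" and P: "P \<in> \<P>" and \<beta>: "almost_geodesic 1 C \<beta> a b"
      and ends: "\<beta> a \<in> nbhd r P" "\<beta> b \<in> nbhd r P" and u: "u \<in> {a..b}" for r P \<beta> a b u
  proof (cases "\<beta> u \<in> nbhd r P")
    case True
    have "0 \<le> 4 * E * (3 + C)" using E(1) assms by auto
    then have "1 * r \<le> l * r" using assms c(1) r r1 by (intro mult_right_mono) (auto simp: l_def)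
    then show ?thesis using True by (auto elim: nbhd_mono)
  next
    case False
    have r': "1 \<le> r" "2 * c \<le> r" "r1 \<le> r" using r r1 by auto
    have P0: "P \<noteq> {}" using ends by (auto simp: nbhd_def)
    have q: "quasi_geodesic 1 C \<beta> a b" and cont: "continuous_on {a..b} \<beta>"
      using \<beta> by (auto simp: almost_geodesic_def)
    define S where "S = {a..b} \<inter> \<beta> -` nbhd r P"
    have S: "closed S" unfolding S_def using cont closed_nbhd by (intro continuous_closed_preimage) auto
    have "a \<in> S" "a \<le> u" "b \<in> S" "u \<le> b" using u ends by (auto simp: S_def)
    obtain s where s: "s \<in> S" "a \<le> s" "s \<le> u" "\<forall>v\<in>S. v \<le> u \<longrightarrow> v \<le> s"
      using \<open>a \<in> S\<close> \<open>a \<le> u\<close> by (rule closed_last[OF S])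
    obtain t where t: "t \<in> S" "u \<le> t" "t \<le> b" "\<forall>v\<in>S. u \<le> v \<longrightarrow> t \<le> v"
      using \<open>b \<in> S\<close> \<open>u \<le> b\<close> by (rule closed_first[OF S])
    have stu: "s < u" "u < t" using s(1,3) t(1,2) False by (auto simp: S_def less_le)
    \<comment> \<open>The ends \<open>s\<close> and \<open>t\<close> are still in the neighbourhood,
      so the excursion is shortened; \<open>e <= 1\<close> keeps the loss at \<open>1 + C\<close> on
      each side.\<close>
    define e where "e = min 1 ((t - s) / 3)"
    have e: "0 < e" "e \<le> 1" "s + e \<le> t - e" using stu by (auto simp: e_def min_def field_simps)
    have st: "s \<in> {a..b}" "t \<in> {a..b}" "\<beta> s \<in> nbhd r P" "\<beta> t \<in> nbhd r P" using s(1) t(1) by (auto simp: S_def)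
    obtain m where m: "(c + 2) * r \<le> 2 ^ m" "D * real m + (c + 2) < r / 2" using r1(2)[OF r'(3)] by auto
    \<comment> \<open>\<open>L >= r >= 2 * c\<close> gives the factor one half, and
      \<open>L <= 2 * r <= (c + 2) * r\<close> fits the depth \<open>m\<close>.\<close>
    define L where "L = nat \<lceil>r\<rceil>"
    have "r \<le> real L" unfolding L_def by (rule real_nat_ceiling_ge)
    then have L: "r \<le> real L" "1 \<le> L" using r' by auto
    have "real L \<le> 2 * r" using r' by (auto simp: L_def) linarith
    also have "\<dots> \<le> (c + 2) * r" using c(1) r' by (intro mult_right_mono) auto
    finally have "real L \<le> 2 ^ m" using m(1) by linarith
    then have L2: "L \<le> 2 ^ m" by (metis of_nat_le_iff of_nat_numeral of_nat_power)
    have out: "\<forall>v\<in>{s + e..t - e}. \<beta> v \<notin> nbhd (D * real m + c) P"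
    proof (intro ballI notI)
      fix v assume v: "v \<in> {s + e..t - e}" "\<beta> v \<in> nbhd (D * real m + c) P"
      have "\<beta> v \<in> nbhd r P" using m(2) r' by (intro nbhd_mono[OF v(2)]) auto
      then have "v \<in> S" using v st e by (auto simp: S_def)
      then show False using s(4) t(4) v e by (cases "v \<le> u") auto
    qed
    have q': "quasi_geodesic 1 C \<beta> (s + e) (t - e)"
      by (rule quasi_geodesic_sub[OF q]) (use st e in auto)
    define w where "w = t - e - (s + e)"
    have "dist (proj P (\<beta> (s + e))) (proj P (\<beta> (t - e))) \<le> c * ((t - e - (s + e)) / real L + 1)"
      by (rule c(2)[OF P P0 q' L(2) L2 out])
    moreover have "c * ((t - e - (s + e)) / real L) \<le> (t - e - (s + e)) / 2"
    proof -
      have "c * (t - e - (s + e)) \<le> real L / 2 * (t - e - (s + e))"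
        using r' L e by (intro mult_right_mono) auto
      then show ?thesis using L(2) by (simp add: divide_le_eq mult.commute)
    qed
    moreover have "dist (\<beta> (s + e)) (proj P (\<beta> (s + e))) \<le> E * (r + (1 + C) + 1)"
    proof (rule E(2)[OF P])
      have "dist (\<beta> s) (\<beta> (s + e)) \<le> 1 + C" using quasi_geodesicD(2)[OF q st(1), of "s + e"] st e by auto
      then show "\<beta> (s + e) \<in> nbhd (r + (1 + C)) P" by (rule nbhd_move[OF st(3)])
    qed (use r' assms in auto)
    moreover have "dist (\<beta> (t - e)) (proj P (\<beta> (t - e))) \<le> E * (r + (1 + C) + 1)"
    proof (rule E(2)[OF P])
      have "dist (\<beta> t) (\<beta> (t - e)) \<le> 1 + C" using quasi_geodesicD(2)[OF q st(2), of "t - e"] st e by auto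
      then show "\<beta> (t - e) \<in> nbhd (r + (1 + C)) P" by (rule nbhd_move[OF st(4)])
    qed (use r' assms in auto)
    moreover have "(t - e - (s + e)) - C \<le> dist (\<beta> (s + e)) (\<beta> (t - e))"
      using quasi_geodesicD(1)[OF q, of "s + e" "t - e"] st e by auto
    moreover have "dist (\<beta> (s + e)) (\<beta> (t - e)) \<le> dist (\<beta> (s + e)) (proj P (\<beta> (s + e))) +
        dist (proj P (\<beta> (s + e))) (proj P (\<beta> (t - e))) + dist (\<beta> (t - e)) (proj P (\<beta> (t - e)))"
      by (smt (verit) dist_commute dist_triangle)
    ultimately have "(t - e - (s + e)) / 2 \<le> C + c + 2 * (E * (r + (1 + C) + 1))"
      unfolding distrib_left[of c] mult_1_right w_def[symmetric] by linarith
    also have "\<dots> \<le> C * r + c * r + 2 * (E * ((3 + C) * r))"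
    proof -
      have C: "C \<le> C * r" "c \<le> c * r" using r' assms c(1) by (auto simp: mult_le_cancel_left1)
      then have "r + (1 + C) + 1 \<le> (3 + C) * r" using r' by (auto simp: algebra_simps)
      then have "E * (r + (1 + C) + 1) \<le> E * ((3 + C) * r)" using E(1) by (intro mult_left_mono) auto
      then show ?thesis using C by linarith
    qed
    finally have len: "t - s \<le> 2 + 2 * (C * r) + 2 * (c * r) + 4 * (E * ((3 + C) * r))" using e by argo
    have "dist (\<beta> s) (\<beta> u) \<le> (u - s) + C" using quasi_geodesicD(2)[OF q st(1) u] stu by auto
    also have "\<dots> \<le> 2 * r + 3 * (C * r) + 2 * (c * r) + 4 * (E * ((3 + C) * r))"
    proof -
      have "C \<le> C * r" using r' assms by (auto simp: mult_le_cancel_left1)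
      then show ?thesis using len stu r' by linarith
    qed
    finally have "\<beta> u \<in> nbhd (r + (2 * r + 3 * (C * r) + 2 * (c * r) + 4 * (E * ((3 + C) * r)))) P"
      by (rule nbhd_move[OF st(3)])
    then show ?thesis by (simp add: l_def algebra_simps)
  qed
  moreover have "1 \<le> l"
  proof -
    have "0 \<le> 4 * E * (3 + C)" using E(1) assms by auto
    then show ?thesis using assms c(1) by (simp add: l_def)
  qed
  moreover have "1 \<le> max r1 (2 * c)" using r1(1) by auto
  ultimately show ?thesis by blast
qed

end

section \<open>Transient sets near almost-geodesics\<close>

lemma compact_infdist_attained:
  assumes "compact B" "B \<noteq> {}"
  obtains b where "b \<in> B" "dist x b = infdist x B"
proof -
  have "continuous_on B (dist x)" by (intro continuous_intros)
  then obtain b where b: "b \<in> B" "\<forall>y\<in>B. dist x b \<le> dist x y"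
    using continuous_attains_inf[OF assms] by blast
  then have "dist x b \<le> infdist x B"
    using assms(2) by (auto simp: infdist_def intro!: cINF_greatest)
  then show ?thesis using that b(1) infdist_le[of b B x] by force
qed

context guessed_paths
begin

text \<open>Here \<open>q\<close> is the parameter of the point farthest from \<open>\<beta>\<close>. If the transient set leaves the ball
  around this point by a long jump in a peripheral set \<open>P\<close>, then \<open>\<beta>\<close> runs along \<open>P\<close>, and the
  escape path jumps in \<open>P\<close> to a point of \<open>\<beta>\<close> at a controlled distance, instead of following the
  jump of the transient set, whose length is not controlled by \<open>r\<close>.\<close>

lemma escape:
  assumes "0 \<le> C"
  shows "\<exists>c\<ge>1. \<exists>r0\<ge>1. \<forall>r\<ge>r0. \<forall>\<beta> a b x y q s0.
    almost_geodesic 1 C \<beta> a b \<longrightarrow> \<beta> a = x \<longrightarrow> \<beta> b = y \<longrightarrow>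
    (\<forall>s\<in>par x y. \<exists>u\<in>{a..b}. dist (\<eta> x y s) (\<beta> u) \<le> r) \<longrightarrow>
    q \<in> par x y \<longrightarrow> (\<forall>u\<in>{a..b}. r \<le> dist (\<eta> x y q) (\<beta> u)) \<longrightarrow> s0 \<in> {0, 1} \<longrightarrow>
    (\<exists>s\<in>closed_segment s0 q. \<exists>u\<in>{a..b}. \<exists>n. real n \<le> c * r \<and> dist (\<beta> u) (\<eta> x y q) \<le> c * r \<and>
       s \<in> {0..1} \<and> \<eta> x y s \<in> - ball (\<eta> x y q) (r/2) \<and>
       (\<eta> x y s, \<beta> u) \<in> steps (1 + C) (- ball (\<eta> x y q) (r/2)) ^^ n)"
proof -
  obtain l r1 where l: "1 \<le> l" "1 \<le> r1" "\<And>r P \<beta> a b u. r1 \<le> r \<Longrightarrow> P \<in> \<P> \<Longrightarrow> almost_geodesic 1 C \<beta> a b \<Longrightarrow>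
     \<beta> a \<in> nbhd r P \<Longrightarrow> \<beta> b \<in> nbhd r P \<Longrightarrow> u \<in> {a..b} \<Longrightarrow> \<beta> u \<in> nbhd (l * r) P"
    using peripheral_quasiconvex[OF assms] by metis
  define c where "c = 2 * l + 4"
  have "\<exists>s\<in>closed_segment s0 q. \<exists>u\<in>{a..b}. \<exists>n. real n \<le> c * r \<and> dist (\<beta> u) p \<le> c * r \<and>
       s \<in> {0..1} \<and> \<eta> x y s \<in> - ball p (r/2) \<and> (\<eta> x y s, \<beta> u) \<in> steps (1 + C) (- ball p (r/2)) ^^ n"
    if r: "r1 + 1 \<le> r" and \<beta>: "almost_geodesic 1 C \<beta> a b" "\<beta> a = x" "\<beta> b = y"
      and near: "\<forall>s\<in>par x y. \<exists>u\<in>{a..b}. dist (\<eta> x y s) (\<beta> u) \<le> r"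
      and q: "q \<in> par x y" "p = \<eta> x y q" and far: "\<forall>u\<in>{a..b}. r \<le> dist p (\<beta> u)" and s0: "s0 \<in> {0, 1}"
    for r \<beta> a b x y q s0 p
  proof -
    have r': "1 < r" "r1 \<le> r + 1" "0 < r" using r l by auto
    have lr: "r \<le> l * r" using r' l by simp
    have cr: "c * r = 2 * (l * r) + 4 * r" by (simp add: c_def algebra_simps)
    have s0p: "s0 \<in> par x y" using s0 by (auto simp: par_def)
    have ab: "a \<le> b" using \<beta>(1) by (auto simp: almost_geodesic_def quasi_geodesic_def)
    have par01: "s \<in> {0..1}" if "s \<in> par x y" for s using that par_subset by blast
    have chain: "(z, w) \<in> steps (1 + C) (- ball p (r/2)) ^^ nat \<lceil>d\<rceil>"
      if "dist w z \<le> d" "d + r/2 \<le> dist p w" for z w d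
    proof -
      have "cball w (dist w z) \<subseteq> - ball p (r/2)"
      proof
        fix v assume "v \<in> cball w (dist w z)"
        then show "v \<in> - ball p (r/2)" using that dist_triangle[of p w v] by (auto simp: dist_commute)
      qed
      moreover have "dist w z \<le> real (nat \<lceil>d\<rceil>)" using that(1) real_nat_ceiling_ge[of d] by linarith
      ultimately show ?thesis using assms by (intro steps_relpow_commute[OF steps_geodesic]) auto
    qed
    show ?thesis
    proof (cases "dist (\<eta> x y s0) p < 2 * r")
      case True
      define u where "u = (if s0 = 0 then a else b)"
      have u: "u \<in> {a..b}" "\<beta> u = \<eta> x y s0" using s0 \<beta>(2,3) ab by (auto simp: u_def)
      have "r \<le> dist p (\<eta> x y s0)" using far u by metis
      moreover have "dist (\<beta> u) p \<le> c * r" unfolding u(2) using True r' lr cr by linarith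
      moreover have "0 \<le> c * r" using cr lr r' by auto
      ultimately show ?thesis using u r' par01[OF s0p]
        by (intro bexI[of _ s0] bexI[of _ u] exI[of _ 0]) auto
    next
      case False
      have "\<not> 2 * r \<le> dist (\<eta> x y q) p" using q(2) r' by auto
      \<comment> \<open>The crossing is taken at radius \<open>2 * r\<close>, so that a geodesic of
        length \<open>r\<close> from \<open>\<eta> x y s\<close> to \<open>\<beta>\<close> avoids
        the ball of radius \<open>r/2\<close>.\<close>
      then obtain s t where st: "s \<in> par x y" "t \<in> par x y" "s \<in> closed_segment s0 q" "t \<in> closed_segment s0 q"
        "2 * r \<le> dist (\<eta> x y s) p" "\<not> 2 * r \<le> dist (\<eta> x y t) p" "jump 1 (\<eta> x y s) (\<eta> x y t)"
        using par_jump[OF s0p q(1), of "\<lambda>s. 2 * r \<le> dist (\<eta> x y s) p"] False by auto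
      obtain u2 where u2: "u2 \<in> {a..b}" "dist (\<eta> x y s) (\<beta> u2) \<le> r" using near st by blast
      obtain u1 where u1: "u1 \<in> {a..b}" "dist (\<eta> x y t) (\<beta> u1) \<le> r" using near st by blast
      have out: "\<eta> x y s \<in> - ball p (r/2)" using st(5) r' by (auto simp: dist_commute)
      show ?thesis
      proof (cases "dist (\<eta> x y s) p \<le> (2 * l + 3) * r")
        case True
        have "dist (\<beta> u2) p \<le> c * r"
          using True u2(2) dist_triangle[of "\<beta> u2" p "\<eta> x y s"] by (auto simp: c_def algebra_simps dist_commute)
        moreover have "real (nat \<lceil>r\<rceil>) \<le> c * r" using cr lr r' by linarith
        moreover have "(\<beta> u2, \<eta> x y s) \<in> steps (1 + C) (- ball p (r/2)) ^^ nat \<lceil>r\<rceil>"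
          using u2 st(5) r' by (intro chain) (auto simp: dist_commute)
        then have "(\<eta> x y s, \<beta> u2) \<in> steps (1 + C) (- ball p (r/2)) ^^ nat \<lceil>r\<rceil>"
          by (rule steps_relpow_commute)
        ultimately show ?thesis using u2(1) st(3) out par01[OF st(1)] by blast
      next
        case False
        have far_s: "2 * (l * r) + 3 * r < dist (\<eta> x y s) p" using False by (simp add: algebra_simps)
        have "1 < dist (\<eta> x y s) (\<eta> x y t)"
          using far_s st(6) lr r' dist_triangle[of "\<eta> x y s" p "\<eta> x y t"] by linarith
        then obtain P where P: "P \<in> \<P>" "\<eta> x y s \<in> nbhd 1 P" "\<eta> x y t \<in> nbhd 1 P"
          using st(7) by (auto simp: jump_def)
        have "\<beta> u2 \<in> nbhd (1 + r) P" "\<beta> u1 \<in> nbhd (1 + r) P"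
          using nbhd_move[OF P(2) u2(2)] nbhd_move[OF P(3) u1(2)] by auto
        then have e: "\<beta> (min u1 u2) \<in> nbhd (1 + r) P" "\<beta> (max u1 u2) \<in> nbhd (1 + r) P"
          by (auto simp: min_def max_def)
        have \<beta>': "almost_geodesic 1 C \<beta> (min u1 u2) (max u1 u2)"
          using almost_geodesic_sub[OF \<beta>(1)] u1(1) u2(1) by auto
        have seg: "closed_segment u1 u2 = {min u1 u2..max u1 u2}"
          by (auto simp: closed_segment_eq_real_ivl)
        \<comment> \<open>Between \<open>u1\<close> and \<open>u2\<close> the distance of
          \<open>\<beta>\<close> from \<open>p\<close> takes the value
          \<open>2 * (l * r) + 2 * r\<close>. There \<open>\<beta>\<close> is within
          \<open>l * (1 + r) < 2 * (l * r)\<close> of \<open>P\<close> (as \<open>r > 1\<close>), so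
          a nearby point \<open>w\<close> of \<open>P\<close> and a geodesic to it stay away from
          \<open>p\<close>.\<close>
        have cont: "continuous_on (closed_segment u1 u2) (\<lambda>u. dist (\<beta> u) p)"
          using \<beta>' by (auto simp: seg almost_geodesic_def intro: continuous_intros)
        have "dist (\<beta> u1) p \<le> 2 * (l * r) + 2 * r"
          using u1(2) st(6) lr r' dist_triangle[of "\<beta> u1" p "\<eta> x y t"] dist_commute[of "\<beta> u1" "\<eta> x y t"] by linarith
        moreover have "2 * (l * r) + 2 * r \<le> dist (\<beta> u2) p"
          using u2(2) far_s dist_triangle[of "\<eta> x y s" p "\<beta> u2"] by (auto simp: dist_commute)
        moreover have "connected ((\<lambda>u. dist (\<beta> u) p) ` closed_segment u1 u2)"
          by (rule connected_continuous_image[OF cont]) auto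
        ultimately have "2 * (l * r) + 2 * r \<in> (\<lambda>u. dist (\<beta> u) p) ` closed_segment u1 u2"
          using connected_contains_Icc[of "(\<lambda>u. dist (\<beta> u) p) ` closed_segment u1 u2" "dist (\<beta> u1) p" "dist (\<beta> u2) p"]
          by auto
        then obtain u where u: "u \<in> closed_segment u1 u2" "dist (\<beta> u) p = 2 * (l * r) + 2 * r" by force
        have uab: "u \<in> {a..b}" using u(1) u1(1) u2(1) by (auto simp: seg min_def max_def split: if_splits)
        have "\<beta> u \<in> nbhd (l * (1 + r)) P"
          using l(3)[OF _ P(1) \<beta>' e] r' u(1) by (simp add: seg add.commute)
        moreover have "l * (1 + r) < 2 * (l * r)" using r' l by (simp add: algebra_simps)
        ultimately obtain w where w: "w \<in> P" "dist (\<beta> u) w < 2 * (l * r)" by (rule nbhd_memE)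
        have "r/2 \<le> dist p w" using u(2) w(2) dist_triangle[of p "\<beta> u" w] r'
          by (simp add: dist_commute)
        then have wA: "w \<in> - ball p (r/2)" by auto
        have "jump (1 + C) (\<eta> x y s) w"
          using P(1,2) w(1) assms nbhd_memI[of w P w "1 + C"] nbhd_mono[of "\<eta> x y s" 1 P "1 + C"]
          by (auto simp: jump_def)
        then have "(\<eta> x y s, w) \<in> steps (1 + C) (- ball p (r/2))" using out wA by (simp add: steps_def)
        moreover have "(w, \<beta> u) \<in> steps (1 + C) (- ball p (r/2)) ^^ nat \<lceil>2 * (l * r)\<rceil>"
          using w(2) u(2) r' by (intro chain) (auto simp: dist_commute)
        ultimately have "(\<eta> x y s, \<beta> u) \<in> steps (1 + C) (- ball p (r/2)) ^^ Suc (nat \<lceil>2 * (l * r)\<rceil>)"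
          by (rule relpow_Suc_I2)
        moreover have "real (Suc (nat \<lceil>2 * (l * r)\<rceil>)) \<le> c * r" using cr lr r' by linarith
        moreover have "dist (\<beta> u) p \<le> c * r" using u(2) cr r' by auto
        ultimately show ?thesis using uab st(3) out par01[OF st(1)] by blast
      qed
    qed
  qed
  moreover have "1 \<le> c" "1 \<le> r1 + 1" using l by (auto simp: c_def)
  ultimately show ?thesis by (intro exI[of _ c] conjI exI[of _ "r1 + 1"]) auto
qed

text \<open>The two detours from a farthest point \<open>p\<close> reach \<open>\<beta>\<close>
  within O(r) of \<open>p\<close>, so the piece of \<open>\<beta>\<close> between them takes O(r)
  steps, whereas all of \<open>\<beta>\<close> may be arbitrarily long. Condition (2) relates
  \<open>p\<close> to the transient set of the two points where the detours begin, so only this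
  short path enters the logarithmic bound.\<close>

lemma T_near_almost_geodesic:
  assumes "0 \<le> C"
  shows "\<exists>R\<ge>0. \<forall>\<beta> a b. almost_geodesic 1 C \<beta> a b \<longrightarrow>
    (\<forall>s\<in>par (\<beta> a) (\<beta> b). \<exists>u\<in>{a..b}. dist (\<eta> (\<beta> a) (\<beta> b) s) (\<beta> u) \<le> R)"
proof -
  obtain c r0 where c: "1 \<le> c" "1 \<le> r0" and esc: "\<forall>r\<ge>r0. \<forall>\<beta> a b x y q s0.
    almost_geodesic 1 C \<beta> a b \<longrightarrow> \<beta> a = x \<longrightarrow> \<beta> b = y \<longrightarrow>
    (\<forall>s\<in>par x y. \<exists>u\<in>{a..b}. dist (\<eta> x y s) (\<beta> u) \<le> r) \<longrightarrow>
    q \<in> par x y \<longrightarrow> (\<forall>u\<in>{a..b}. r \<le> dist (\<eta> x y q) (\<beta> u)) \<longrightarrow> s0 \<in> {0, 1} \<longrightarrow>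
    (\<exists>s\<in>closed_segment s0 q. \<exists>u\<in>{a..b}. \<exists>n. real n \<le> c * r \<and> dist (\<beta> u) (\<eta> x y q) \<le> c * r \<and>
       s \<in> {0..1} \<and> \<eta> x y s \<in> - ball (\<eta> x y q) (r/2) \<and>
       (\<eta> x y s, \<beta> u) \<in> steps (1 + C) (- ball (\<eta> x y q) (r/2)) ^^ n)"
    using escape[OF assms] by (elim exE conjE)
  obtain K where K: "0 \<le> K" "\<And>m n A x y p. (x, y) \<in> steps (1 + C) A ^^ n \<Longrightarrow> n \<le> 2 ^ m \<Longrightarrow> x \<in> A \<Longrightarrow>
     p \<in> T x y \<Longrightarrow> \<exists>a\<in>A. dist p a \<le> D * real m + K"
    using T_near_steps[of "1 + C"] by metis
  \<comment> \<open>\<open>4 * c + C + 1\<close> counts the steps: two detours of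
    \<open>c * r\<close> each and a piece of \<open>\<beta>\<close> with
    \<open>2 * (c * r) + C + 1\<close>. \<open>K + D\<close> absorbs the errors of the final
    estimate.\<close>
  define c' where "c' = 4 * c + C + 1 + K + D"
  obtain r1 where r1: "\<And>r. r1 \<le> r \<Longrightarrow> \<exists>m::nat. c' * r \<le> 2 ^ m \<and> D * m + c' < r / 2"
    using log_bound[of D c'] D_ge_1 c K assms by (auto simp: c'_def)
  define R where "R = max r0 r1"
  have "\<exists>u\<in>{a..b}. dist (\<eta> (\<beta> a) (\<beta> b) s) (\<beta> u) \<le> R"
    if \<beta>: "almost_geodesic 1 C \<beta> a b" and s: "s \<in> par (\<beta> a) (\<beta> b)" for \<beta> a b s
  proof -
    define x y where xy: "x = \<beta> a" "y = \<beta> b"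
    have q: "quasi_geodesic 1 C \<beta> a b" and ab: "a \<le> b" using \<beta> by (auto simp: almost_geodesic_def quasi_geodesic_def)
    define B where "B = \<beta> ` {a..b}"
    have B: "compact B" "B \<noteq> {}"
      using \<beta> ab by (auto simp: B_def almost_geodesic_def intro: compact_continuous_image)
    have "compact (par x y)"
      using closed_par par_subset compact_Icc by (metis closed_Int_compact inf.absorb_iff1)
    moreover have "par x y \<noteq> {}" by (auto simp: par_def)
    moreover have "continuous_on (par x y) (\<lambda>s. infdist (\<eta> x y s) B)"
      using continuous_on_subset[OF continuous_\<eta> par_subset] by (intro continuous_intros)
    ultimately obtain t where t: "t \<in> par x y" "\<forall>s\<in>par x y. infdist (\<eta> x y s) B \<le> infdist (\<eta> x y t) B"
      using continuous_attains_sup by blast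
    define r where "r = infdist (\<eta> x y t) B"
    have near: "\<exists>u\<in>{a..b}. dist (\<eta> x y s) (\<beta> u) \<le> r" if "s \<in> par x y" for s
    proof -
      obtain z where "z \<in> B" "dist (\<eta> x y s) z = infdist (\<eta> x y s) B"
        using B by (rule compact_infdist_attained)
      then have "z \<in> B" "dist (\<eta> x y s) z \<le> r" using t(2) that by (auto simp: r_def)
      then show ?thesis unfolding B_def by blast
    qed
    have far: "r \<le> dist (\<eta> x y t) (\<beta> u)" if "u \<in> {a..b}" for u
      using that by (auto simp: r_def B_def intro: infdist_le)
    have "r \<le> R"
    proof (rule ccontr)
      assume "\<not> r \<le> R"
      then have r: "r0 \<le> r" "r1 \<le> r" "1 \<le> r" using c by (auto simp: R_def)
      obtain m where m: "c' * r \<le> 2 ^ m" "D * real m + c' < r / 2" using r1[OF r(2)] by auto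
      define p where "p = \<eta> x y t"
      define A where "A = - ball p (r/2)"
      \<comment> \<open>The ends lie on \<open>\<beta>\<close>, so a parameter at distance
        \<open>r >= 1\<close> from it belongs to a genuine transient point.\<close>
      have t0: "t \<noteq> 0" "t \<noteq> 1" using far[of a] far[of b] r(3) ab xy by auto
      then have pT: "p \<in> T x y" and t01: "t \<in> {0..1}" using t(1) by (auto simp: par_def p_def)
      note esc' = esc[rule_format, OF r(1) \<beta> xy[symmetric] near t(1) far, folded p_def, folded A_def]
      obtain s1 u1 n1 where 1: "s1 \<in> closed_segment 0 t" "u1 \<in> {a..b}" "real n1 \<le> c * r" "dist (\<beta> u1) p \<le> c * r"
        "s1 \<in> {0..1}" "\<eta> x y s1 \<in> A" "(\<eta> x y s1, \<beta> u1) \<in> steps (1 + C) A ^^ n1"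
        using esc'[of 0] by auto
      obtain s2 u2 n2 where 2: "s2 \<in> closed_segment 1 t" "u2 \<in> {a..b}" "real n2 \<le> c * r" "dist (\<beta> u2) p \<le> c * r"
        "s2 \<in> {0..1}" "\<eta> x y s2 \<in> A" "(\<eta> x y s2, \<beta> u2) \<in> steps (1 + C) A ^^ n2"
        using esc'[of 1] by auto
      define n3 where "n3 = nat \<lceil>2 * (c * r) + C\<rceil>"
      have "0 \<le> c * r" using c(1) r(3) by auto
      then have n3: "real n3 \<le> 2 * (c * r) + C + 1" using assms by (auto simp: n3_def)
      have "\<bar>u1 - u2\<bar> \<le> 2 * (c * r) + C"
        using quasi_geodesicD(1)[OF q 1(2) 2(2)] 1(4) 2(4) dist_triangle2[of "\<beta> u1" "\<beta> u2" p] by linarith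
      then have u12: "\<bar>u1 - u2\<bar> \<le> real n3" using real_nat_ceiling_ge[of "2 * (c * r) + C"] unfolding n3_def by linarith
      have "\<beta> ` closed_segment u1 u2 \<subseteq> A"
      proof -
        have "closed_segment u1 u2 \<subseteq> {a..b}" using 1(2) 2(2) by (auto simp: closed_segment_eq_real_ivl split: if_splits)
        then show ?thesis using far r(3) unfolding A_def p_def by force
      qed
      then have "(\<beta> u1, \<beta> u2) \<in> steps (1 + C) A ^^ n3"
        by (rule steps_quasi_geodesic[OF q 1(2) 2(2) u12 order.refl])
      then have "(\<eta> x y s1, \<beta> u2) \<in> steps (1 + C) A ^^ (n1 + n3)" using 1(7) by (auto simp: relpow_add)
      moreover have "(\<beta> u2, \<eta> x y s2) \<in> steps (1 + C) A ^^ n2" using 2(7) by (rule steps_relpow_commute)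
      ultimately have path: "(\<eta> x y s1, \<eta> x y s2) \<in> steps (1 + C) A ^^ (n1 + n3 + n2)"
        using relpow_add[of "n1 + n3" n2] by blast
      have "real (n1 + n3 + n2) \<le> c' * r"
      proof -
        have "C \<le> C * r" "0 \<le> K * r" "0 \<le> D * r" using r(3) assms K D_ge_1 by (auto simp: mult_le_cancel_left1)
        then have "4 * (c * r) + C + 1 \<le> c' * r" using r(3) by (simp add: c'_def algebra_simps)
        then show ?thesis using 1(3) 2(3) n3 by simp
      qed
      then have "real (n1 + n3 + n2) \<le> 2 ^ m" using m(1) by linarith
      then have n: "n1 + n3 + n2 \<le> 2 ^ m" by (metis of_nat_le_iff of_nat_numeral of_nat_power)
      \<comment> \<open>The detours begin on opposite sides of \<open>t\<close>, hence
        \<open>p\<close> lies in the part of \<open>T x y\<close> to which (2) applies.\<close>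
      have "t \<in> closed_segment s1 s2" using 1(1) 2(1) t01 by (auto simp: closed_segment_eq_real_ivl split: if_splits)
      then obtain p' where p': "p' \<in> T (\<eta> x y s1) (\<eta> x y s2)" "dist p p' \<le> D"
        using T_extend[OF 1(5) 2(5), of p x y] pT p_def by auto
      obtain w where w: "w \<in> A" "dist p' w \<le> D * real m + K" using K(2)[OF path n 1(6) p'(1)] by blast
      have "r/2 \<le> dist p w" using w(1) by (auto simp: A_def)
      then show False using w(2) p'(2) m(2) dist_triangle[of p w p'] c(1) assms by (auto simp: c'_def)
    qed
    then show ?thesis using near[of s] s xy by force
  qed
  moreover have "0 \<le> R" using c by (auto simp: R_def)
  ultimately show ?thesis by blast
qed

end

section \<open>Relative hyperbolicity and transient points\<close>

lemma dHaus_leI: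
  assumes "0 \<le> r" "\<And>x. x \<in> A \<Longrightarrow> \<exists>y\<in>B. dist x y \<le> r" "\<And>y. y \<in> B \<Longrightarrow> \<exists>x\<in>A. dist y x \<le> r"
  shows "dHaus A B \<le> ereal r"
proof -
  have "A \<subseteq> nbhd r B" "B \<subseteq> nbhd r A" using assms(2,3) nbhd_memI by blast+
  then show ?thesis unfolding dHaus_def using assms(1) by (intro Inf_lower) auto
qed

section \<open>Reversed paths, entrance points and exit points\<close>

lemma almost_geodesic_reverse:
  assumes "almost_geodesic K C \<beta> a b"
  shows "almost_geodesic K C (\<lambda>t. \<beta> (- t)) (- b) (- a)"
proof -
  have "continuous_on {- b..- a} (\<lambda>t. \<beta> (- t))"
  proof (rule continuous_on_compose2[of "{a..b}" \<beta>])
    show "continuous_on {a..b} \<beta>" using assms by (simp add: almost_geodesic_def)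
    show "continuous_on {- b..- a} (uminus :: real \<Rightarrow> real)" by (intro continuous_intros)
  qed auto
  moreover have "quasi_geodesic K C (\<lambda>t. \<beta> (- t)) (- b) (- a)"
    unfolding quasi_geodesic_def
  proof (intro conjI ballI)
    have q: "quasi_geodesic K C \<beta> a b" using assms by (simp add: almost_geodesic_def)
    show "- b \<le> - a" using q by (simp add: quasi_geodesic_def)
    fix s t assume "s \<in> {- b..- a}" "t \<in> {- b..- a}"
    then have "- s \<in> {a..b}" "- t \<in> {a..b}" by auto
    moreover have "\<bar>- s - - t\<bar> = \<bar>s - t\<bar>" by simp
    ultimately show "\<bar>s - t\<bar> / K - C \<le> dist (\<beta> (- s)) (\<beta> (- t))"
      "dist (\<beta> (- s)) (\<beta> (- t)) \<le> K * \<bar>s - t\<bar> + C"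
      using q unfolding quasi_geodesic_def by metis+
  qed
  ultimately show ?thesis by (simp add: almost_geodesic_def)
qed

lemma entrance_pt_reverse: "entrance_pt (\<lambda>t. \<beta> (- t)) (- b) (- a) A = exit_pt \<beta> a b A"
proof -
  have "uminus ` {t \<in> {- b..- a}. \<beta> (- t) \<in> A} = {t \<in> {a..b}. \<beta> t \<in> A}"
    by (force intro: image_eqI[where x = "- t" for t])
  then show ?thesis by (simp add: entrance_pt_def exit_pt_def Inf_real_def)
qed

lemma all_less_3: "(\<forall>i<3::nat. Q i) \<longleftrightarrow> Q 0 \<and> Q 1 \<and> Q 2"
  by (auto simp: numeral_3_eq_3 numeral_2_eq_2 less_Suc_eq)

context guessed_paths
begin

text \<open>Consider \<open>\<beta>\<close> up to its entrance point. If its ends have far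
  projections, its transient set passes near \<open>proj P (\<beta> a)\<close>, and hence so does
  some point of this part of \<open>\<beta>\<close>. That point lies in
  \<open>nbhd \<sigma> P\<close> already, so it is the entrance point.\<close>

lemma entrance_near_proj:
  assumes "0 \<le> C"
  shows "\<exists>\<sigma>0. \<forall>\<sigma>\<ge>\<sigma>0. \<exists>\<delta>. \<forall>P\<in>\<P>. \<forall>\<beta> a b. almost_geodesic 1 C \<beta> a b \<longrightarrow>
    \<beta> ` {a..b} \<inter> nbhd \<sigma> P \<noteq> {} \<longrightarrow> dist (entrance_pt \<beta> a b (nbhd \<sigma> P)) (proj P (\<beta> a)) \<le> \<delta>"
proof -
  obtain R where R: "0 \<le> R" "\<forall>\<beta> a b. almost_geodesic 1 C \<beta> a b \<longrightarrow>
    (\<forall>s\<in>par (\<beta> a) (\<beta> b). \<exists>u\<in>{a..b}. dist (\<eta> (\<beta> a) (\<beta> b) s) (\<beta> u) \<le> R)"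
    using T_near_almost_geodesic[OF assms] by (elim exE conjE)
  obtain E where E: "0 \<le> E" "\<forall>P\<in>\<P>. \<forall>x y. P \<noteq> {} \<longrightarrow> E < dist (proj P x) (proj P y) \<longrightarrow>
     (\<exists>p\<in>T x y. dist p (proj P x) \<le> E) \<and> (\<exists>p\<in>T x y. dist p (proj P y) \<le> E)"
    using T_passes_proj by (elim exE conjE)
  obtain F where F: "1 \<le> F" "\<And>P x r. P \<in> \<P> \<Longrightarrow> 0 \<le> r \<Longrightarrow> x \<in> nbhd r P \<Longrightarrow> dist x (proj P x) \<le> F * (r + 1)"
    using dist_proj by metis
  \<comment> \<open>Projections lie in \<open>nbhd (4 * D + 1) P\<close>; the threshold for
    \<open>\<sigma>\<close> makes \<open>nbhd \<sigma> P\<close> contain everything within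
    \<open>E + R\<close> of them.\<close>
  have "dist (entrance_pt \<beta> a b (nbhd \<sigma> P)) (proj P (\<beta> a)) \<le> E + R + F * (\<sigma> + 1)"
    if \<sigma>: "4 * D + 1 + (E + R) \<le> \<sigma>" and P: "P \<in> \<P>" and \<beta>: "almost_geodesic 1 C \<beta> a b"
      and meet: "\<beta> ` {a..b} \<inter> nbhd \<sigma> P \<noteq> {}" for \<sigma> P \<beta> a b
  proof -
    have \<sigma>0: "0 \<le> \<sigma>" using \<sigma> D_ge_1 E R by auto
    define S where "S = {t \<in> {a..b}. \<beta> t \<in> nbhd \<sigma> P}"
    have "S = {a..b} \<inter> \<beta> -` nbhd \<sigma> P" by (auto simp: S_def)
    then have "closed S"
      using \<beta> closed_nbhd by (auto simp: almost_geodesic_def intro!: continuous_closed_preimage)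
    moreover have bb: "bdd_below S" by (auto simp: S_def intro!: bdd_belowI[of _ a])
    moreover have "S \<noteq> {}" using meet by (auto simp: S_def)
    ultimately have inf: "Inf S \<in> S" using closed_contains_Inf by blast
    define t where "t = Inf S"
    have t: "t \<in> {a..b}" "\<beta> t \<in> nbhd \<sigma> P" using inf by (auto simp: S_def t_def)
    have e: "entrance_pt \<beta> a b (nbhd \<sigma> P) = \<beta> t" by (simp add: entrance_pt_def t_def S_def)
    have P0: "P \<noteq> {}" using t by (auto simp: nbhd_def)
    have pos: "0 \<le> F * (\<sigma> + 1)" using F \<sigma>0 by auto
    show ?thesis
    proof (cases "E < dist (proj P (\<beta> a)) (proj P (\<beta> t))")
      case True
      then obtain p where p: "p \<in> T (\<beta> a) (\<beta> t)" "dist p (proj P (\<beta> a)) \<le> E" using E(2) P P0 by blast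
      obtain s where s: "s \<in> par (\<beta> a) (\<beta> t)" "p = \<eta> (\<beta> a) (\<beta> t) s" using p(1) by (rule T_parE)
      have "almost_geodesic 1 C \<beta> a t" using almost_geodesic_sub[OF \<beta>] t(1) by auto
      then obtain u where u: "u \<in> {a..t}" "dist p (\<beta> u) \<le> R" using R(2) s by blast
      have d: "dist (proj P (\<beta> a)) (\<beta> u) \<le> E + R"
        using p(2) u(2) dist_triangle[of "proj P (\<beta> a)" "\<beta> u" p] by (auto simp: dist_commute)
      have "\<beta> u \<in> nbhd (4 * D + 1 + (E + R)) P" by (rule nbhd_move[OF proj_mem[OF P0] d])
      then have "u \<in> S" using u(1) t(1) nbhd_mono[OF _ \<sigma>] by (auto simp: S_def)
      then have "t \<le> u" unfolding t_def using bb by (rule cInf_lower)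
      then have "u = t" using u(1) by auto
      then show ?thesis using d pos by (simp add: e dist_commute)
    next
      case False
      then show ?thesis using F(2)[OF P \<sigma>0 t(2)] R(1) dist_triangle[of "\<beta> t" "proj P (\<beta> a)" "proj P (\<beta> t)"]
        by (simp add: e dist_commute)
    qed
  qed
  then show ?thesis by blast
qed

lemma exit_near_proj:
  assumes "almost_geodesic 1 C \<beta> a b" "\<beta> ` {a..b} \<inter> nbhd \<sigma> P \<noteq> {}"
    and "\<And>\<beta> a b. almost_geodesic 1 C \<beta> a b \<Longrightarrow> \<beta> ` {a..b} \<inter> nbhd \<sigma> P \<noteq> {} \<Longrightarrow>
      dist (entrance_pt \<beta> a b (nbhd \<sigma> P)) (proj P (\<beta> a)) \<le> \<delta>"
  shows "dist (exit_pt \<beta> a b (nbhd \<sigma> P)) (proj P (\<beta> b)) \<le> \<delta>"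
proof -
  have "(\<lambda>t. \<beta> (- t)) ` {- b..- a} = \<beta> ` {a..b}"
    by (simp flip: image_image)
  then show ?thesis
    using assms(3)[OF almost_geodesic_reverse[OF assms(1)]] assms(2) by (simp add: entrance_pt_reverse)
qed

text \<open>The path \<open>\<eta> x y\<close> for side 0 starts on side 2 and ends on side 1. Where
  its transient points leave the neighbourhood of side 2, a short jump gives case (C) and a jump
  along a peripheral set gives case (P). The exit and entrance points at a vertex are then both near
  the projection of this vertex, whence the factor 2 before \<open>\<delta>\<close>.\<close>

lemma tree_graded: "star_asymptotically_tree_graded \<P>"
  unfolding star_asymptotically_tree_graded_def
proof (intro allI impI)
  fix C :: real assume C: "0 \<le> C"
  obtain R where R: "0 \<le> R" "\<forall>\<beta> a b. almost_geodesic 1 C \<beta> a b \<longrightarrow>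
    (\<forall>s\<in>par (\<beta> a) (\<beta> b). \<exists>u\<in>{a..b}. dist (\<eta> (\<beta> a) (\<beta> b) s) (\<beta> u) \<le> R)"
    using T_near_almost_geodesic[OF C] by (elim exE conjE)
  obtain \<sigma>0 where \<sigma>0: "\<forall>\<sigma>\<ge>\<sigma>0. \<exists>\<delta>. \<forall>P\<in>\<P>. \<forall>\<beta> a b. almost_geodesic 1 C \<beta> a b \<longrightarrow>
    \<beta> ` {a..b} \<inter> nbhd \<sigma> P \<noteq> {} \<longrightarrow> dist (entrance_pt \<beta> a b (nbhd \<sigma> P)) (proj P (\<beta> a)) \<le> \<delta>"
    using entrance_near_proj[OF C] by (elim exE)
  \<comment> \<open>\<open>D\<close> for one use of (3), and \<open>2 * D\<close> for turning a
    transient set to the orientation of a side.\<close>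
  define R' where "R' = R + 3 * D"
  define \<sigma> where "\<sigma> = max \<sigma>0 (R' + 1)"
  have \<sigma>: "R' + 1 \<le> \<sigma>" "0 \<le> R'" "R \<le> R'" "0 \<le> \<sigma>" using R D_ge_1 by (auto simp: \<sigma>_def R'_def)
  have "\<sigma>0 \<le> \<sigma>" by (simp add: \<sigma>_def)
  then obtain \<delta> where \<delta>: "\<forall>P\<in>\<P>. \<forall>\<beta> a b. almost_geodesic 1 C \<beta> a b \<longrightarrow>
    \<beta> ` {a..b} \<inter> nbhd \<sigma> P \<noteq> {} \<longrightarrow> dist (entrance_pt \<beta> a b (nbhd \<sigma> P)) (proj P (\<beta> a)) \<le> \<delta>"
    using \<sigma>0 by blast
  show "\<exists>\<sigma> \<delta>. \<forall>\<gamma> a b. almost_geodesic_triangle 1 C \<gamma> a b \<longrightarrow>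
        (\<exists>p. \<forall>i<3. \<gamma> i ` {a i..b i} \<inter> cball p \<sigma> \<noteq> {}) \<or>
        (\<exists>P\<in>\<P>.
           (\<forall>i<3. \<gamma> i ` {a i..b i} \<inter> nbhd \<sigma> P \<noteq> {}) \<and>
           (\<forall>i<3. let j = (i + 1) mod 3 in
              dist (exit_pt (\<gamma> i) (a i) (b i) (nbhd \<sigma> P))
                   (entrance_pt (\<gamma> j) (a j) (b j) (nbhd \<sigma> P)) \<le> \<delta>))"
  proof (rule exI[of _ \<sigma>], rule exI[of _ "2 * \<delta>"], intro allI impI)
    fix \<gamma> :: "nat \<Rightarrow> real \<Rightarrow> 'a" and a b
    assume tri: "almost_geodesic_triangle 1 C \<gamma> a b"
    have ag: "almost_geodesic 1 C (\<gamma> i) (a i) (b i)" if "i < 3" for i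
      using tri that by (simp add: almost_geodesic_triangle_def)
    have ab: "a i \<le> b i" if "i < 3" for i
      using ag[OF that] by (simp add: almost_geodesic_def quasi_geodesic_def)
    define x y z where "x = \<gamma> 0 (a 0)" and "y = \<gamma> 1 (a 1)" and "z = \<gamma> 2 (a 2)"
    have xyz: "\<gamma> 0 (b 0) = y" "\<gamma> 1 (b 1) = z" "\<gamma> 2 (b 2) = x"
      using tri by (simp_all add: almost_geodesic_triangle_def all_less_3 x_def y_def z_def flip: numeral_2_eq_2)
    have side0: "\<exists>u\<in>{a 0..b 0}. dist (\<eta> x y s) (\<gamma> 0 u) \<le> R" if "s \<in> par x y" for s
      using R(2)[rule_format, OF ag, of 0 s] that xyz(1) by (simp add: x_def)
    have side1: "\<exists>u\<in>{a 1..b 1}. dist p (\<gamma> 1 u) \<le> R" if "p \<in> T y z" for p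
      using R(2)[rule_format, of "\<gamma> 1" "a 1" "b 1"] ag[of 1] T_parE[OF that] xyz by (metis y_def one_less_numeral_iff semiring_norm(77))
    have side2: "\<exists>u\<in>{a 2..b 2}. dist p (\<gamma> 2 u) \<le> R" if "p \<in> T z x" for p
      using R(2)[rule_format, of "\<gamma> 2" "a 2" "b 2"] ag[of 2] T_parE[OF that] xyz by (metis z_def lessI numeral_3_eq_3 numeral_2_eq_2)
    define A where "A s \<longleftrightarrow> (\<exists>u\<in>{a 2..b 2}. dist (\<eta> x y s) (\<gamma> 2 u) \<le> R')" for s
    have B: "\<exists>u\<in>{a 1..b 1}. dist (\<eta> x y s) (\<gamma> 1 u) \<le> R'" if s: "s \<in> par x y" "\<not> A s" for s
    proof -
      consider "s = 0" | "s = 1" | "\<eta> x y s \<in> T x y" using s(1) by (auto simp: par_def)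
      then show ?thesis
      proof cases
        case 1
        then have "A s" using xyz(3) ab[of 2] \<sigma> by (auto simp: A_def intro!: bexI[of _ "b 2"])
        then show ?thesis using s(2) by blast
      next
        case 2
        then show ?thesis using ab[of 1] \<sigma> by (auto simp: y_def intro!: bexI[of _ "a 1"])
      next
        case 3
        then obtain q where q: "q \<in> T x z \<union> T z y" "dist (\<eta> x y s) q \<le> D" using T_triangle by blast
        have close: "dist (\<eta> x y s) v \<le> R'" if "dist q w \<le> 2 * D" "dist w v \<le> R" for w v
          using that q(2) dist_triangle[of "\<eta> x y s" v q] dist_triangle[of q v w] by (auto simp: R'_def)
        show ?thesis
          using q(1)
        proof
          assume "q \<in> T x z"
          then obtain w where w: "w \<in> T z x" "dist q w \<le> 2 * D" using T_commute by blast
          then have "A s" using side2[OF w(1)] close[OF w(2)] by (auto simp: A_def)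
          then show ?thesis using s(2) by blast
        next
          assume "q \<in> T z y"
          then obtain w where w: "w \<in> T y z" "dist q w \<le> 2 * D" using T_commute by blast
          then show ?thesis using side1[OF w(1)] close[OF w(2)] by auto
        qed
      qed
    qed
    have ends: "0 \<in> par x y" "1 \<in> par x y" by (auto simp: par_def)
    have A0: "A 0" using xyz(3) ab[of 2] \<sigma> by (auto simp: A_def intro!: bexI[of _ "b 2"])
    show "(\<exists>p. \<forall>i<3. \<gamma> i ` {a i..b i} \<inter> cball p \<sigma> \<noteq> {}) \<or>
        (\<exists>P\<in>\<P>.
           (\<forall>i<3. \<gamma> i ` {a i..b i} \<inter> nbhd \<sigma> P \<noteq> {}) \<and>
           (\<forall>i<3. let j = (i + 1) mod 3 in
              dist (exit_pt (\<gamma> i) (a i) (b i) (nbhd \<sigma> P))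
                   (entrance_pt (\<gamma> j) (a j) (b j) (nbhd \<sigma> P)) \<le> 2 * \<delta>))"
    proof (cases "A 1")
      case True
      \<comment> \<open>The vertex \<open>y\<close> of sides 0 and 1 is then near side 2 as well and
        serves as centre.\<close>
      then obtain u where u: "u \<in> {a 2..b 2}" "dist y (\<gamma> 2 u) \<le> \<sigma>" using \<sigma> by (force simp: A_def)
      have "y \<in> \<gamma> 0 ` {a 0..b 0}" "y \<in> \<gamma> 1 ` {a 1..b 1}"
        using ab[of 0] ab[of 1] xyz(1) by (force simp: y_def)+
      moreover have "y \<in> cball y \<sigma>" using \<sigma> by simp
      moreover have "\<gamma> 2 u \<in> \<gamma> 2 ` {a 2..b 2} \<inter> cball y \<sigma>" using u by simp
      ultimately show ?thesis unfolding all_less_3 by blast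
    next
      case False
      obtain s t where st: "s \<in> par x y" "t \<in> par x y" "A s" "\<not> A t" "jump 1 (\<eta> x y s) (\<eta> x y t)"
        using par_jump[OF ends, of A] A0 False by metis
      obtain u0 where u0: "u0 \<in> {a 0..b 0}" "dist (\<eta> x y s) (\<gamma> 0 u0) \<le> R'" using side0[OF st(1)] \<sigma> by force
      obtain u1 where u1: "u1 \<in> {a 1..b 1}" "dist (\<eta> x y t) (\<gamma> 1 u1) \<le> R'" using B[OF st(2,4)] by blast
      obtain u2 where u2: "u2 \<in> {a 2..b 2}" "dist (\<eta> x y s) (\<gamma> 2 u2) \<le> R'" using st(3) by (auto simp: A_def)
      from st(5) consider "dist (\<eta> x y s) (\<eta> x y t) \<le> 1"
        | P where "P \<in> \<P>" "\<eta> x y s \<in> nbhd 1 P" "\<eta> x y t \<in> nbhd 1 P" by (auto simp: jump_def)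
      then show ?thesis
      proof cases
        case 1
        then have "dist (\<eta> x y s) (\<gamma> 1 u1) \<le> \<sigma>"
          using u1(2) \<sigma>(1) dist_triangle[of "\<eta> x y s" "\<gamma> 1 u1" "\<eta> x y t"] by linarith
        moreover have "dist (\<eta> x y s) (\<gamma> 0 u0) \<le> \<sigma>" "dist (\<eta> x y s) (\<gamma> 2 u2) \<le> \<sigma>"
          using u0(2) u2(2) \<sigma>(1) by linarith+
        ultimately have "\<gamma> 0 u0 \<in> \<gamma> 0 ` {a 0..b 0} \<inter> cball (\<eta> x y s) \<sigma>"
          "\<gamma> 1 u1 \<in> \<gamma> 1 ` {a 1..b 1} \<inter> cball (\<eta> x y s) \<sigma>" "\<gamma> 2 u2 \<in> \<gamma> 2 ` {a 2..b 2} \<inter> cball (\<eta> x y s) \<sigma>"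
          using u0(1) u1(1) u2(1) by auto
        then show ?thesis unfolding all_less_3 by blast
      next
        case (2 P)
        have mono: "v \<in> nbhd \<sigma> P" if "v \<in> nbhd (1 + R') P" for v
          using nbhd_mono[OF that] \<sigma>(1) by simp
        have "\<gamma> 0 u0 \<in> nbhd \<sigma> P" "\<gamma> 1 u1 \<in> nbhd \<sigma> P" "\<gamma> 2 u2 \<in> nbhd \<sigma> P"
          using mono nbhd_move[OF 2(2) u0(2)] nbhd_move[OF 2(3) u1(2)] nbhd_move[OF 2(2) u2(2)] by blast+
        then have meet: "\<forall>i<3. \<gamma> i ` {a i..b i} \<inter> nbhd \<sigma> P \<noteq> {}"
          unfolding all_less_3 using u0(1) u1(1) u2(1) by blast
        have entrance: "dist (entrance_pt \<beta> a b (nbhd \<sigma> P)) (proj P (\<beta> a)) \<le> \<delta>"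
          if "almost_geodesic 1 C \<beta> a b" "\<beta> ` {a..b} \<inter> nbhd \<sigma> P \<noteq> {}" for \<beta> a b
          using \<delta> 2(1) that by blast
        have "dist (exit_pt (\<gamma> i) (a i) (b i) (nbhd \<sigma> P))
                   (entrance_pt (\<gamma> j) (a j) (b j) (nbhd \<sigma> P)) \<le> 2 * \<delta>"
          if "i < 3" "j < 3" "\<gamma> i (b i) = \<gamma> j (a j)" for i j
        proof -
          have "dist (exit_pt (\<gamma> i) (a i) (b i) (nbhd \<sigma> P)) (proj P (\<gamma> i (b i))) \<le> \<delta>"
            using meet that(1) by (intro exit_near_proj[OF ag[OF that(1)]] entrance) auto
          moreover have "dist (entrance_pt (\<gamma> j) (a j) (b j) (nbhd \<sigma> P)) (proj P (\<gamma> j (a j))) \<le> \<delta>"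
            using meet that(2) by (intro entrance ag) auto
          ultimately show ?thesis
            using that(3) dist_triangle2[of "exit_pt (\<gamma> i) (a i) (b i) (nbhd \<sigma> P)"
                "entrance_pt (\<gamma> j) (a j) (b j) (nbhd \<sigma> P)" "proj P (\<gamma> j (a j))"] by simp
        qed
        then have "\<forall>i<3. let j = (i + 1) mod 3 in
              dist (exit_pt (\<gamma> i) (a i) (b i) (nbhd \<sigma> P))
                   (entrance_pt (\<gamma> j) (a j) (b j) (nbhd \<sigma> P)) \<le> 2 * \<delta>"
          using tri by (simp add: almost_geodesic_triangle_def Let_def)
        then show ?thesis using meet 2(1) by blast
      qed
    qed
  qed
qed

text \<open>If a point of \<open>\<beta>\<close> near a transient point were deep, (3) at the ends
  of the peripheral piece would place the transient point near an outer part of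
  \<open>\<beta>\<close> or, by (6), near an end of the piece; either way the deep point would be
  within \<open>c\<close> of an end. Conversely, the transient set has to jump past any given
  \<open>\<beta> u\<close>; a jump along a peripheral set makes \<open>\<beta> u\<close> deep unless
  it is within \<open>c\<close> of a point of \<open>\<beta>\<close> near an end of the
  jump.\<close>

lemma T_Hausdorff_transient:
  assumes C: "0 \<le> C"
  shows "\<exists>\<mu> c0 L. \<forall>c\<ge>c0. \<forall>\<beta> a b. almost_geodesic 1 C \<beta> a b \<longrightarrow>
    dHaus (T (\<beta> a) (\<beta> b)) (trans_pts \<P> \<mu> c \<beta> a b) \<le> ereal (L + c)"
proof -
  obtain R where R: "0 \<le> R" "\<forall>\<beta> a b. almost_geodesic 1 C \<beta> a b \<longrightarrow>
    (\<forall>s\<in>par (\<beta> a) (\<beta> b). \<exists>u\<in>{a..b}. dist (\<eta> (\<beta> a) (\<beta> b) s) (\<beta> u) \<le> R)"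
    using T_near_almost_geodesic[OF C] by (elim exE conjE)
  have T_near: "\<exists>u\<in>{a..b}. dist p (\<beta> u) \<le> R" if "almost_geodesic 1 C \<beta> a b" "p \<in> T (\<beta> a) (\<beta> b)" for \<beta> a b p
    using T_parE[OF that(2)] R(2) that(1) by metis
  obtain K where K: "\<forall>P\<in>\<P>. \<forall>x\<in>nbhd (1 + R) P. \<forall>y\<in>nbhd (1 + R) P. K \<le> dist x y \<longrightarrow>
      T x y \<subseteq> cball x K \<union> cball y K \<and> T x y \<inter> nbhd D P \<noteq> {}"
    using T_peripheral by blast
  obtain E where E: "0 \<le> E" "\<And>x y p. dist x y \<le> K \<Longrightarrow> p \<in> T x y \<Longrightarrow> dist x p \<le> E"
    using T_small[of K] by blast
  define c0 where "c0 = 2 * R + 2 * D + 2 * C + max K 0 + E"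
  define L where "L = 3 * R + 1 + 2 * C + D"
  \<comment> \<open>The radius \<open>1 + R\<close> consists of 1 for the ends of a jump and
    \<open>R\<close> for passing from them to \<open>\<beta>\<close>.\<close>
  have "dHaus (T (\<beta> a) (\<beta> b)) (trans_pts \<P> (1 + R) c \<beta> a b) \<le> ereal (L + c)"
    if c: "c0 \<le> c" and \<beta>: "almost_geodesic 1 C \<beta> a b" for c \<beta> a b
  proof (rule dHaus_leI)
    have q: "quasi_geodesic 1 C \<beta> a b" and ab: "a \<le> b" using \<beta> by (auto simp: almost_geodesic_def quasi_geodesic_def)
    have c': "2 * R + 2 * D + 2 * C \<le> c" "R + 2 * D + K \<le> c" "R + 2 * D + E \<le> c" "0 \<le> c"
      using c R E C D_ge_1 by (auto simp: c0_def)
    show "0 \<le> L + c" using c' R C D_ge_1 by (auto simp: L_def)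
    define x y where xy: "x = \<beta> a" "y = \<beta> b"
    show "\<exists>z\<in>trans_pts \<P> (1 + R) c \<beta> a b. dist p z \<le> L + c" if p: "p \<in> T (\<beta> a) (\<beta> b)" for p
    proof -
      obtain u where u: "u \<in> {a..b}" "dist p (\<beta> u) \<le> R" using T_near[OF \<beta> p] by blast
      have "\<beta> u \<notin> deep_pts \<P> (1 + R) c \<beta> a b"
      proof
        assume "\<beta> u \<in> deep_pts \<P> (1 + R) c \<beta> a b"
        \<comment> \<open>The deep point may be attained at a parameter \<open>v\<close> other than
          \<open>u\<close>, as \<open>\<beta>\<close> need not be injective.\<close>
        then obtain s t v P where st: "a \<le> s" "s \<le> t" "t \<le> b" "v \<in> {s..t}" "\<beta> u = \<beta> v"
          "P \<in> \<P>" "\<beta> s \<in> nbhd (1 + R) P" "\<beta> t \<in> nbhd (1 + R) P"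
          and far: "c < dist (\<beta> v) (\<beta> s)" "c < dist (\<beta> v) (\<beta> t)"
          unfolding deep_pts_def by force
        have pv: "dist p (\<beta> v) \<le> R" using u(2) st(5) by simp
        \<comment> \<open>If \<open>\<beta> w\<close> is near \<open>p\<close> and \<open>r\<close>
          lies between \<open>w\<close> and \<open>v\<close>, then \<open>r\<close> is at least as
          close to \<open>v\<close> as \<open>w\<close> is, so \<open>\<beta> r\<close> is within
          \<open>c\<close> of \<open>\<beta> v\<close>.\<close>
        have between: False
          if w: "w \<in> {a..b}" "dist (\<beta> w) p \<le> R + 2 * D" and r: "r = s \<or> r = t" "r \<in> closed_segment w v" for w r
        proof -
          have rvab: "r \<in> {a..b}" "v \<in> {a..b}" using r st by auto
          have "\<bar>w - v\<bar> \<le> 2 * R + 2 * D + C"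
            using quasi_geodesicD(1)[OF q w(1) rvab(2)] w(2) pv dist_triangle[of "\<beta> w" "\<beta> v" p] by linarith
          moreover have "\<bar>v - r\<bar> \<le> \<bar>w - v\<bar>" using r(2) by (auto simp: closed_segment_eq_real_ivl split: if_splits)
          ultimately have "dist (\<beta> v) (\<beta> r) \<le> c"
            using quasi_geodesicD(2)[OF q rvab(2,1)] c'(1) by linarith
          then show False using far r(1) by auto
        qed
        obtain q1 where q1: "q1 \<in> T x (\<beta> s) \<union> T (\<beta> s) y" "dist p q1 \<le> D" using T_triangle p xy by blast
        from q1(1) show False
        proof
          assume "q1 \<in> T x (\<beta> s)"
          moreover have "almost_geodesic 1 C \<beta> a s" using almost_geodesic_sub[OF \<beta>] st by auto
          ultimately obtain w where w: "w \<in> {a..s}" "dist q1 (\<beta> w) \<le> R" using T_near xy by blast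
          have "dist (\<beta> w) p \<le> R + 2 * D" using w(2) q1(2) D_ge_1 dist_triangle[of "\<beta> w" p q1]
            by (simp add: dist_commute)
          moreover have "s \<in> closed_segment w v" using w(1) st by (simp add: closed_segment_eq_real_ivl)
          ultimately show False using between[of w s] w(1) st by auto
        next
          assume "q1 \<in> T (\<beta> s) y"
          then obtain q2 where q2: "q2 \<in> T (\<beta> s) (\<beta> t) \<union> T (\<beta> t) y" "dist q1 q2 \<le> D" using T_triangle by blast
          have pq2: "dist p q2 \<le> 2 * D" using q1(2) q2(2) dist_triangle[of p q2 q1] by simp
          from q2(1) show False
          proof
            assume "q2 \<in> T (\<beta> t) y"
            moreover have "almost_geodesic 1 C \<beta> t b" using almost_geodesic_sub[OF \<beta>] st by auto
            ultimately obtain w where w: "w \<in> {t..b}" "dist q2 (\<beta> w) \<le> R" using T_near xy by blast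
            have "dist (\<beta> w) p \<le> R + 2 * D" using w(2) pq2 dist_triangle[of "\<beta> w" p q2]
              by (simp add: dist_commute)
            moreover have "t \<in> closed_segment w v" using w(1) st by (simp add: closed_segment_eq_real_ivl)
            ultimately show False using between[of w t] w(1) st by auto
          next
            assume q2': "q2 \<in> T (\<beta> s) (\<beta> t)"
            have close: "dist (\<beta> v) z \<le> R + 2 * D + k" if "dist z q2 \<le> k" for z k
              using that pv pq2 dist_triangle[of "\<beta> v" z q2] dist_triangle[of "\<beta> v" q2 p] by (simp add: dist_commute)
            show False
            proof (cases "K \<le> dist (\<beta> s) (\<beta> t)")
              case True
              then have "T (\<beta> s) (\<beta> t) \<subseteq> cball (\<beta> s) K \<union> cball (\<beta> t) K" using K st(6-8) by blast
              then have "dist (\<beta> s) q2 \<le> K \<or> dist (\<beta> t) q2 \<le> K" using q2' by auto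
              then show False using close[of "\<beta> s" K] close[of "\<beta> t" K] c'(2) far by auto
            next
              case False
              then have "dist (\<beta> s) q2 \<le> E" using q2' by (intro E(2)) auto
              then show False using close[of "\<beta> s" E] c'(3) far by auto
            qed
          qed
        qed
      qed
      then have "\<beta> u \<in> trans_pts \<P> (1 + R) c \<beta> a b" using u(1) by (simp add: trans_pts_def)
      moreover have "dist p (\<beta> u) \<le> L + c" using u(2) c'(4) R C D_ge_1 by (simp add: L_def)
      ultimately show ?thesis by blast
    qed
    show "\<exists>p\<in>T (\<beta> a) (\<beta> b). dist z p \<le> L + c" if z: "z \<in> trans_pts \<P> (1 + R) c \<beta> a b" for z
    proof -
      obtain u where u: "u \<in> {a..b}" "z = \<beta> u" using z by (auto simp: trans_pts_def)
      have near: "\<exists>u\<in>{a..b}. dist (\<eta> x y s) (\<beta> u) \<le> R" if "s \<in> par x y" for s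
        using R(2) \<beta> that xy by blast
      have reach: ?thesis if s: "s \<in> par x y" "dist z (\<eta> x y s) \<le> L + c - D" for s
      proof -
        obtain p where "p \<in> T x y" "dist (\<eta> x y s) p \<le> D" using par_T[OF s(1)] by blast
        then show ?thesis using s(2) dist_triangle[of z p "\<eta> x y s"] xy by (intro bexI[of _ p]) auto
      qed
      define A where "A s \<longleftrightarrow> (\<exists>v\<in>{a..u}. dist (\<eta> x y s) (\<beta> v) \<le> R)" for s
      have ends: "0 \<in> par x y" "1 \<in> par x y" by (auto simp: par_def)
      have A0: "A 0" using u(1) xy R(1) by (auto simp: A_def intro!: bexI[of _ a])
      \<comment> \<open>As \<open>u\<close> separates \<open>v\<close> from \<open>w\<close>,
        closeness of \<open>\<beta> v\<close> and \<open>\<beta> w\<close> bounds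
        \<open>w - v\<close>, hence \<open>w - u\<close>.\<close>
      have close: "dist z (\<beta> w) \<le> r + 2 * C" if "v \<in> {a..u}" "w \<in> {u..b}" "dist (\<beta> v) (\<beta> w) \<le> r" for v w r
      proof -
        have "w - v \<le> r + C" using quasi_geodesicD(1)[OF q, of v w] that u(1) by auto
        then show ?thesis using quasi_geodesicD(2)[OF q, of u w] that u by auto
      qed
      show ?thesis
      proof (cases "A 1")
        case True
        then obtain v where v: "v \<in> {a..u}" "dist (\<beta> b) (\<beta> v) \<le> R" using xy by (auto simp: A_def)
        have "dist z (\<eta> x y 1) \<le> R + 2 * C" using close[OF v(1), of b R] v(2) u(1) xy by (simp add: dist_commute)
        then show ?thesis using reach[OF ends(2)] c'(4) R(1) by (simp add: L_def)
      next
        case False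
        obtain s t where st: "s \<in> par x y" "t \<in> par x y" "A s" "\<not> A t" "jump 1 (\<eta> x y s) (\<eta> x y t)"
          using par_jump[OF ends, of A] A0 False by metis
        obtain v where v: "v \<in> {a..u}" "dist (\<eta> x y s) (\<beta> v) \<le> R" using st(3) by (auto simp: A_def)
        obtain w where w: "w \<in> {a..b}" "dist (\<eta> x y t) (\<beta> w) \<le> R" using near[OF st(2)] by blast
        have uw: "u < w" using w st(4) by (force simp: A_def)
        from st(5) consider "dist (\<eta> x y s) (\<eta> x y t) \<le> 1"
          | P where "P \<in> \<P>" "\<eta> x y s \<in> nbhd 1 P" "\<eta> x y t \<in> nbhd 1 P" by (auto simp: jump_def)
        then show ?thesis
        proof cases
          case 1
          have "dist (\<beta> v) (\<beta> w) \<le> 2 * R + 1"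
            using 1 v(2) w(2) dist_triangle[of "\<beta> v" "\<beta> w" "\<eta> x y s"] dist_triangle[of "\<eta> x y s" "\<beta> w" "\<eta> x y t"]
            by (simp add: dist_commute)
          then have "dist z (\<beta> w) \<le> 2 * R + 1 + 2 * C" using close[OF v(1), of w] w(1) uw by auto
          then have "dist z (\<eta> x y t) \<le> 3 * R + 1 + 2 * C"
            using w(2) dist_triangle[of z "\<eta> x y t" "\<beta> w"] by (simp add: dist_commute)
          then show ?thesis using reach[OF st(2)] c'(4) by (simp add: L_def)
        next
          case (2 P)
          have "\<beta> v \<in> nbhd (1 + R) P" "\<beta> w \<in> nbhd (1 + R) P"
            using nbhd_move[OF 2(2) v(2)] nbhd_move[OF 2(3) w(2)] by auto
          moreover have "z \<notin> deep_pts \<P> (1 + R) c \<beta> a b" using z by (simp add: trans_pts_def)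
          moreover have "z \<in> \<beta> ` {a..b}" "a \<le> v" "v \<le> w" "w \<le> b" "z \<in> \<beta> ` {v..w}"
            using u v(1) w(1) uw by auto
          ultimately have "\<not> (c < dist z (\<beta> v) \<and> c < dist z (\<beta> w))"
            using 2(1) unfolding deep_pts_def by blast
          then consider "dist z (\<beta> v) \<le> c" | "dist z (\<beta> w) \<le> c" by linarith
          then show ?thesis
          proof cases
            case 1
            then have "dist z (\<eta> x y s) \<le> c + R" using v(2) dist_triangle[of z "\<eta> x y s" "\<beta> v"]
              by (simp add: dist_commute)
            then show ?thesis using reach[OF st(1)] R(1) C by (simp add: L_def)
          next
            case 2
            then have "dist z (\<eta> x y t) \<le> c + R" using w(2) dist_triangle[of z "\<eta> x y t" "\<beta> w"]
              by (simp add: dist_commute)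
            then show ?thesis using reach[OF st(2)] R(1) C by (simp add: L_def)
          qed
        qed
      qed
    qed
  qed
  then show ?thesis by blast
qed

end

theorem theorem4p2:
  fixes \<P> :: "'a::metric_space set set"
    and \<eta> :: "'a \<Rightarrow> 'a \<Rightarrow> real \<Rightarrow> 'a"
    and trans :: "'a \<Rightarrow> 'a \<Rightarrow> 'a set"
    and D :: real
  assumes "geodesic_space TYPE('a)"
    and "\<And>x y. path (\<eta> x y) \<and> pathstart (\<eta> x y) = x \<and> pathfinish (\<eta> x y) = y"
    and "\<And>x y. closed (trans x y) \<and> trans x y \<subseteq> path_image (\<eta> x y)"
    and "\<And>x y. dist x y \<le> 2 \<Longrightarrow> diam_le (trans x y) D"
    and "\<And>x y s t. s \<in> {0..1} \<Longrightarrow> t \<in> {0..1} \<Longrightarrow>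
           dHaus (trans (\<eta> x y s) (\<eta> x y t))
                 ((trans x y \<inter> \<eta> x y ` closed_segment s t) \<union> {\<eta> x y s, \<eta> x y t}) \<le> ereal D"
    and "\<And>x y z. trans x y \<subseteq> nbhd D (trans x z \<union> trans z y)"
    and "\<And>x y s t. s \<in> {0..1} \<Longrightarrow> t \<in> {0..1} \<Longrightarrow>
           \<not> (\<exists>P\<in>\<P>. \<eta> x y s \<in> P \<and> \<eta> x y t \<in> P) \<Longrightarrow>
           \<exists>z\<in>trans x y. z \<in> \<eta> x y ` closed_segment s t"
    and "\<forall>K. \<exists>B. \<forall>P\<in>\<P>. \<forall>Q\<in>\<P>. P \<noteq> Q \<longrightarrow> diam_le (nbhd K P \<inter> nbhd K Q) B"
    and "\<forall>k. \<exists>K. \<forall>P\<in>\<P>. \<forall>x y. x \<in> nbhd k P \<and> y \<in> nbhd k P \<and> dist x y \<ge> K \<longrightarrow>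
           trans x y \<subseteq> cball x K \<union> cball y K \<and> trans x y \<inter> nbhd D P \<noteq> {}"
  shows "rel_hyperbolic \<P> \<and>
    (\<forall>C\<ge>0. \<exists>\<mu> c\<^sub>0 L. \<forall>c\<ge>c\<^sub>0. \<forall>\<beta> a b x y.
       almost_geodesic 1 C \<beta> a b \<and> \<beta> a = x \<and> \<beta> b = y \<longrightarrow>
       dHaus (trans x y) (trans_pts \<P> \<mu> c \<beta> a b) \<le> ereal (L + c))"
proof -
  \<comment> \<open>The added 1 leaves room for replacing infima by actual distances; the maximum
    with 0 ensures \<open>D' >= 1\<close>.\<close>
  define D' where "D' = max D 0 + 1"
  have D': "D < D'" "1 \<le> D'" by (auto simp: D'_def)
  have diam: "dist x y \<le> B" if "diam_le S B" "x \<in> S" "y \<in> S" for x y :: 'a and S B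
    using that diameter_bounded_bound[of S x y] by (auto simp: diam_le_def)
  interpret guessed_paths \<P> \<eta> trans D'
  proof
    show "geodesic_space TYPE('a)" by (rule assms(1))
    show "1 \<le> D'" by (rule D')
    show "path (\<eta> x y)" "\<eta> x y 0 = x" "\<eta> x y 1 = y" for x y
      using assms(2)[of x y] by (auto simp: pathstart_def pathfinish_def)
    show "closed (trans x y)" "trans x y \<subseteq> path_image (\<eta> x y)" for x y using assms(3) by auto
    show "dist p q \<le> D'" if "dist x y \<le> 2" "p \<in> trans x y" "q \<in> trans x y" for x y p q
      using diam[OF assms(4)[OF that(1)] that(2,3)] D' by linarith
    show "\<exists>q\<in>(trans x y \<inter> \<eta> x y ` closed_segment s t) \<union> {\<eta> x y s, \<eta> x y t}. dist p q \<le> D'"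
      if "s \<in> {0..1}" "t \<in> {0..1}" "p \<in> trans (\<eta> x y s) (\<eta> x y t)" for x y s t p
      by (rule dHaus_leD[OF assms(5)[OF that(1,2)] D'(1) that(3)])
    show "\<exists>p\<in>trans (\<eta> x y s) (\<eta> x y t). dist q p \<le> D'"
      if "s \<in> {0..1}" "t \<in> {0..1}" "q \<in> (trans x y \<inter> \<eta> x y ` closed_segment s t) \<union> {\<eta> x y s, \<eta> x y t}"
      for x y s t q
      by (rule dHaus_leD[OF _ D'(1) that(3)], subst dHaus_commute) (rule assms(5)[OF that(1,2)])
    show "\<exists>q\<in>trans x z \<union> trans z y. dist p q \<le> D'" if "p \<in> trans x y" for x y z p
    proof -
      have "p \<in> nbhd D (trans x z \<union> trans z y)" using assms(6) that by blast
      then show ?thesis using D'(1) by (rule nbhd_memE) (blast intro: less_imp_le)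
    qed
    show "trans x y \<inter> \<eta> x y ` closed_segment s t \<noteq> {}"
      if "s \<in> {0..1}" "t \<in> {0..1}" "\<forall>P\<in>\<P>. \<eta> x y s \<in> P \<longrightarrow> \<eta> x y t \<notin> P" for x y s t
      using assms(7)[OF that(1,2), of x y] that(3) by blast
    show "\<exists>B. \<forall>P\<in>\<P>. \<forall>Q\<in>\<P>. P \<noteq> Q \<longrightarrow>
      (\<forall>x \<in> nbhd k P \<inter> nbhd k Q. \<forall>y \<in> nbhd k P \<inter> nbhd k Q. dist x y \<le> B)" for k
    proof -
      obtain B where B: "\<forall>P\<in>\<P>. \<forall>Q\<in>\<P>. P \<noteq> Q \<longrightarrow> diam_le (nbhd k P \<inter> nbhd k Q) B"
        using spec[OF assms(8), of k] by (rule exE)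
      show ?thesis
        by (rule exI[of _ B], intro ballI impI, rule diam) (use B in auto)
    qed
    show "\<exists>K. \<forall>P\<in>\<P>. \<forall>x\<in>nbhd k P. \<forall>y\<in>nbhd k P. K \<le> dist x y \<longrightarrow>
      trans x y \<subseteq> cball x K \<union> cball y K \<and> trans x y \<inter> nbhd D' P \<noteq> {}" for k
    proof -
      obtain K where K: "\<forall>P\<in>\<P>. \<forall>x y. x \<in> nbhd k P \<and> y \<in> nbhd k P \<and> dist x y \<ge> K \<longrightarrow>
           trans x y \<subseteq> cball x K \<union> cball y K \<and> trans x y \<inter> nbhd D P \<noteq> {}" using spec[OF assms(9), of k] by (rule exE)
      have "nbhd D P \<subseteq> nbhd D' P" for P :: "'a set" using nbhd_mono[of _ D P D'] D'(1) by auto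
      then show ?thesis using K by (intro exI[of _ K]) blast
    qed
  qed
  have "rel_hyperbolic \<P>" unfolding rel_hyperbolic_def alpha1_def using assms(8) alpha2_peripherals tree_graded by blast
  moreover have "\<exists>\<mu> c\<^sub>0 L. \<forall>c\<ge>c\<^sub>0. \<forall>\<beta> a b x y.
       almost_geodesic 1 C \<beta> a b \<and> \<beta> a = x \<and> \<beta> b = y \<longrightarrow>
       dHaus (trans x y) (trans_pts \<P> \<mu> c \<beta> a b) \<le> ereal (L + c)" if C: "0 \<le> C" for C
  proof -
    obtain \<mu> c0 L where h: "\<forall>c\<ge>c0. \<forall>\<beta> a b. almost_geodesic 1 C \<beta> a b \<longrightarrow>
        dHaus (trans (\<beta> a) (\<beta> b)) (trans_pts \<P> \<mu> c \<beta> a b) \<le> ereal (L + c)"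
      using T_Hausdorff_transient[OF C] by (elim exE)
    show ?thesis
      by (rule exI[of _ \<mu>], rule exI[of _ c0], rule exI[of _ L]) (use h in auto)
  qed
  ultimately show ?thesis by blast
qed

end
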